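(* Let $n\geq 1$ be an integer and consider the $L_p$-Minkowski equation $$\det(\nabla^2 h+h I)=f\,h^{p-1}\quad\text{on } \mathbb{S}^n .$$ (i) If $p=-n-1$, then there exists a positive function $f\in C^\alpha(\mathbb{S}^n)$ for some $\alpha\in(0,1)$ such that this equation admits no solution. (ii) If $p<-n-1$, then there exists a Hölder continuous function $f$ on $\mathbb{S}^n$ which is positive on $\mathbb{S}^n$ minus the two poles $\{\pm e_{n+1}\}$, such that this equation admits no solution.
   Context: $\mathbb{S}^n\subset\mathbb{R}^{n+1}$ is the unit sphere with its round metric; $\nabla^2 h$ is the covariant Hessian of $h$ with respect to an orthonormal frame, and $I$ is the identity matrix. A solution means a classical solution: a positive function $h\in C^2(\mathbb{S}^n)$ with $\nabla^2h+hI$ positive semidefinite (so that $h$ is the support function of a convex body containing the origin in its interior) satisfying the equation pointwise. $e_{n+1}=(0,\dots,0,1)$. *)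

theory Defs
  imports "HOL-Analysis.Analysis"
begin

text \<open>The unit sphere S^n is sphere 0 1 in real^'m, with CARD('m) = n+1.
  A function h on S^n is represented by any h :: real^'m => real; only its
  values on the sphere matter, through the 0-homogeneous extension.\<close>

definition hom0 :: "(real^'m \<Rightarrow> real) \<Rightarrow> real^'m \<Rightarrow> real" where
  "hom0 h x = h (x /\<^sub>R norm x)"

text \<open>h is C^2 on the sphere (its 0-homogeneous extension is C^2 on R^(n+1) minus 0),
  and H x is the Euclidean Hessian matrix of that extension at x.  By the Gauss
  formula for the unit sphere (the radial derivative of the extension vanishes),
  the covariant Hessian of h at x on tangent vectors u, v is  u . (H x *v v).\<close>

definition C2_sphere_hess :: "(real^'m \<Rightarrow> real) \<Rightarrow> (real^'m \<Rightarrow> real^'m^'m) \<Rightarrow> bool" where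
  "C2_sphere_hess h H \<longleftrightarrow>
     (\<exists>g :: real^'m \<Rightarrow> real^'m. \<forall>x. x \<noteq> 0 \<longrightarrow>
        (hom0 h has_derivative (\<lambda>v. g x \<bullet> v)) (at x) \<and>
        (g has_derivative (\<lambda>v. H x *v v)) (at x))
     \<and> continuous_on (- {0}) H"

definition sphere_frame :: "real^'m \<Rightarrow> ('n \<Rightarrow> real^'m) \<Rightarrow> bool" where
  "sphere_frame x e \<longleftrightarrow>
     (\<forall>i j. e i \<bullet> e j = (if i = j then 1 else 0)) \<and> (\<forall>i. e i \<bullet> x = 0)"

text \<open>Classical solution of det(\<nabla>^2 h + h I) = f h^(p-1) on S^n
  (matrix taken w.r.t. any orthonormal frame; 'n indexes the frame, CARD('n) = n).\<close>

definition Lp_Minkowski_solution ::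
  "'n::finite itself \<Rightarrow> real \<Rightarrow> (real^'m \<Rightarrow> real) \<Rightarrow> (real^'m \<Rightarrow> real) \<Rightarrow> bool" where
  "Lp_Minkowski_solution _ p f h \<longleftrightarrow>
     (\<exists>H. C2_sphere_hess h H \<and>
       (\<forall>x \<in> sphere 0 1.
          h x > 0 \<and>
          (\<forall>v. v \<bullet> x = 0 \<longrightarrow> v \<bullet> (H x *v v) + h x * (v \<bullet> v) \<ge> 0) \<and>
          (\<forall>e :: 'n \<Rightarrow> real^'m. sphere_frame x e \<longrightarrow>
              det (\<chi> i j. e i \<bullet> (H x *v e j) + (if i = j then h x else 0))
                = f x * h x powr (p - 1))))"

definition holder_on :: "real \<Rightarrow> ('a::metric_space) set \<Rightarrow> ('a \<Rightarrow> real) \<Rightarrow> bool" where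
  "holder_on \<alpha> S f \<longleftrightarrow> (\<exists>C. \<forall>x\<in>S. \<forall>y\<in>S. \<bar>f x - f y\<bar> \<le> C * dist x y powr \<alpha>)"


end

theory Submission
  imports Defs
begin

text \<open>Write \<open>N = n + 1\<close>, \<open>q = - p - N \<ge> 0\<close>, and let \<open>\<beta> = 2 + q / N\<close>. If \<open>h\<close> is a solution, extended
  1-homogeneously to \<open>k\<close>, then \<open>G = k\<^sup>\<beta> / \<beta>\<close> is convex, \<open>\<beta>\<close>-homogeneous and satisfies
  \<open>det D\<^sup>2G = (\<beta> - 1) w\<close> with \<open>w x = |x|\<^sup>q f (x / |x|)\<close>, an equation that no longer contains \<open>h\<close>, and
  \<open>\<nabla>G\<close> is a bijection of the space. Let \<open>B\<close> be a symmetric matrix of determinant 1 with \<open>|B - I| \<le> t\<close>, and let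
  \<open>G\<^sup>*\<close> be the Legendre conjugate of \<open>G\<close>. Young's inequality at the points \<open>B\<^sup>-\<^sup>1 x\<close> and \<open>B y\<close>, where
  \<open>y = \<nabla>G x\<close>, gives \<open>G (B\<^sup>-\<^sup>1 x) \<ge> G x + G\<^sup>* y - G\<^sup>* (B y)\<close>. Inserting this into a decreasing cut-off
  and integrating over \<open>y\<close>, the first-order terms cancel because \<open>y \<mapsto> B y\<close> preserves volume. Changing
  variables back to \<open>x\<close> leaves \<open>\<integral> \<psi> (G x) (w (B x) - w x) dx \<le> K t\<^sup>2\<close>, a derivative-free form of the
  Kazdan-Warner type obstruction. It is violated as soon as \<open>w\<close> increases at first order in \<open>t\<close> under
  matrices \<open>B\<close> that shrink the axis \<open>e\<close> and stretch its complement, as happens for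
  \<open>f = 2 - (e \<bullet> x)\<^sup>2\<close> when \<open>q = 0\<close>, and for \<open>f = |x - (e \<bullet> x) e|\<^sup>q\<close> when \<open>q > 0\<close>.\<close>

section \<open>Determinants\<close>

text \<open>In the Leibniz sum a permutation moving \<open>k\<close> picks a zero entry from row
  \<open>k\<close>. Those fixing \<open>k\<close> correspond through \<open>b\<close> to the
  permutations of the smaller index type, with the same signs.\<close>

lemma det_row_single:
  fixes M :: "real^'m^'m" and b :: "'n::finite \<Rightarrow> 'm"
  assumes b: "bij_betw b UNIV (- {k})" and row: "\<And>j. j \<noteq> k \<Longrightarrow> M $ k $ j = 0"
  shows "det M = M $ k $ k * det (\<chi> i j. M $ b i $ b j)"
proof -
  let ?U = "UNIV :: 'm set" and ?V = "UNIV :: 'n set"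
  let ?t = "\<lambda>p. of_int (sign p) * (\<Prod>i\<in>?U. M $ i $ p i)"
  let ?N = "(\<chi> i j. M $ b i $ b j) :: real^'n^'n"
  have inj: "inj b" and im: "b ` ?V = - {k}"
    using b by (auto simp: bij_betw_def)
  have sub: "{p. p permutes - {k}} \<subseteq> {p. p permutes ?U}"
    by (auto intro: permutes_subset)
  have "det M = sum ?t {p. p permutes ?U}"
    by (simp add: det_def)
  also have "\<dots> = sum ?t {p. p permutes - {k}}"
  proof (rule sum.mono_neutral_right[OF _ sub])
    show "\<forall>p\<in>{p. p permutes ?U} - {p. p permutes - {k}}. ?t p = 0"
    proof
      fix p assume "p \<in> {p. p permutes ?U} - {p. p permutes - {k}}"
      then have "p k \<noteq> k"
        unfolding permutes_def by auto
      then have "(\<Prod>i\<in>?U. M $ i $ p i) = 0"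
        using row by (intro prod_zero) auto
      then show "?t p = 0" by simp
    qed
  qed (simp add: finite_permutations)
  also have "\<dots> = (\<Sum>p | p permutes ?V. ?t (map_permutation ?V b p))"
  proof (rule sum.reindex_bij_betw[symmetric])
    show "bij_betw (map_permutation ?V b) {p. p permutes ?V} {p. p permutes - {k}}"
    proof -
      have "map_permutation ?V b = (\<lambda>p x. if x \<in> - {k} then b (p (inv_into ?V b x)) else x)"
        by (simp add: map_permutation_def restrict_id_def im fun_eq_iff)
      then show ?thesis
        using bij_betw_permutations[OF b] by simp
    qed
  qed
  also have "\<dots> = (\<Sum>p | p permutes ?V. M $ k $ k * (of_int (sign p) * (\<Prod>i\<in>?V. ?N $ i $ p i)))"
  proof (rule sum.cong[OF refl])
    fix p assume "p \<in> {p. p permutes ?V}"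
    then have p: "p permutes ?V" by simp
    let ?q = "map_permutation ?V b p"
    have qk: "?q k = k"
      using map_permutation_permutes[OF b p] by (simp add: permutes_def)
    have "(\<Prod>i\<in>?U. M $ i $ ?q i) = M $ k $ k * (\<Prod>i\<in>- {k}. M $ i $ ?q i)"
      by (subst prod.remove[of _ k]) (auto simp: qk Compl_eq_Diff_UNIV)
    also have "(\<Prod>i\<in>- {k}. M $ i $ ?q i) = (\<Prod>i\<in>?V. M $ b i $ ?q (b i))"
      by (rule prod.reindex_bij_betw[OF b, symmetric])
    also have "\<dots> = (\<Prod>i\<in>?V. ?N $ i $ p i)"
      by (simp add: map_permutation_apply inj)
    finally show "?t ?q = M $ k $ k * (of_int (sign p) * (\<Prod>i\<in>?V. ?N $ i $ p i))"
      by (simp add: sign_map_permutation inj p)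
  qed
  finally show ?thesis
    by (simp add: det_def sum_distrib_left)
qed

text \<open>Schur complement with respect to a single pivot.\<close>
lemma det_schur_single:
  fixes M :: "real^'m^'m" and b :: "'n::finite \<Rightarrow> 'm"
  assumes b: "bij_betw b UNIV (- {k})" and nz: "M $ k $ k \<noteq> 0"
  shows "det M = M $ k $ k * det (\<chi> i j. M $ b i $ b j - M $ b i $ k * M $ k $ b j / M $ k $ k)"
proof -
  define c where "c i = (if i = k then 0 else M $ i $ k / M $ k $ k)" for i
  \<comment> \<open>Elimination matrix: left multiplication by \<open>L\<close> subtracts
    \<open>c i\<close> times row \<open>k\<close> from row \<open>i\<close>, which clears column
    \<open>k\<close> outside the pivot.\<close>
  define L :: "real^'m^'m" where "L = (\<chi> i j. if j = k then (if i = k then 1 else - c i) else if i = j then 1 else 0)"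
  have LM: "(L ** M) $ i $ j = M $ i $ j - c i * M $ k $ j" for i j
  proof -
    have "(L ** M) $ i $ j = (\<Sum>l\<in>UNIV. L $ i $ l * M $ l $ j)"
      by (simp add: matrix_matrix_mult_def)
    also have "\<dots> = (\<Sum>l\<in>UNIV. (if l = i then M $ l $ j else 0) + (if l = k then - c i * M $ l $ j else 0))"
      by (rule sum.cong) (auto simp: L_def c_def)
    also have "\<dots> = M $ i $ j - c i * M $ k $ j"
      by (simp add: sum.distrib)
    finally show ?thesis .
  qed
  have inj: "b i = b j \<longleftrightarrow> i = j" and ne: "b i \<noteq> k" for i j
    using b by (auto simp: bij_betw_def inj_def)
  have "det L = 1 * det (\<chi> i j. L $ b i $ b j)"
    by (subst det_row_single[OF b]) (auto simp: L_def)
  also have "(\<chi> i j. L $ b i $ b j) = mat 1"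
    by (simp add: L_def mat_def vec_eq_iff inj ne)
  finally have "det L = 1" by simp
  \<comment> \<open>The cleared entries form a column; transposing turns it into a row, the form
    \<open>det_row_single\<close> expects.\<close>
  then have "det M = det (transpose (L ** M))"
    by (simp add: det_mul)
  also have "\<dots> = transpose (L ** M) $ k $ k * det (\<chi> i j. transpose (L ** M) $ b i $ b j)"
    by (rule det_row_single[OF b]) (auto simp: transpose_def LM c_def nz)
  also have "(\<chi> i j. transpose (L ** M) $ b i $ b j)
      = transpose (\<chi> i j. M $ b i $ b j - M $ b i $ k * M $ k $ b j / M $ k $ k)"
    by (simp add: transpose_def LM c_def vec_eq_iff ne)
  finally show ?thesis
    by (simp add: transpose_def[of "L ** M"] LM c_def)
qed

lemma det_scaleR_matrix: "det (c *\<^sub>R A) = c ^ CARD('n) * det A" for A :: "real^'n^'n"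
proof -
  have "c *\<^sub>R A = (\<chi> i. c *s A $ i)"
    by (simp add: vec_eq_iff)
  then show ?thesis
    using det_rows_mul[of "\<lambda>_. c" "\<lambda>i. A $ i"] by simp
qed

section \<open>Integration\<close>

text \<open>Real values are read as vectors in \<open>real^1\<close>, and the vector-valued change
  of variables is applied there.\<close>

lemma absolutely_integrable_change_of_variables_real:
  fixes f :: "real^'m::{finite,wellorder} \<Rightarrow> real" and g :: "real^'m::_ \<Rightarrow> real^'m::_"
  assumes S: "S \<in> sets lebesgue"
    and der: "\<And>x. x \<in> S \<Longrightarrow> (g has_derivative (\<lambda>v. B x *v v)) (at x within S)"
    and inj: "inj_on g S"
    and int: "(\<lambda>x. \<bar>det (B x)\<bar> * f (g x)) absolutely_integrable_on S"
  shows "f absolutely_integrable_on (g ` S)"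
    and "integral (g ` S) f = integral S (\<lambda>x. \<bar>det (B x)\<bar> * f (g x))"
proof -
  let ?f = "\<lambda>x. vec (f x) :: real^1"
  have vec1: "(\<lambda>x. \<bar>det (matrix ((*v) (B x)))\<bar> *\<^sub>R ?f (g x)) = (\<lambda>x. vec (\<bar>det (B x)\<bar> * f (g x)))"
    by (simp add: fun_eq_iff vec_eq_iff matrix_of_matrix_vector_mul)
  have "(\<lambda>x. \<bar>det (matrix ((*v) (B x)))\<bar> *\<^sub>R ?f (g x)) absolutely_integrable_on S \<and>
      integral S (\<lambda>x. \<bar>det (matrix ((*v) (B x)))\<bar> *\<^sub>R ?f (g x))
        = vec (integral S (\<lambda>x. \<bar>det (B x)\<bar> * f (g x)))"
    unfolding vec1 using int by (simp add: absolutely_integrable_on_1_iff integral_on_1_eq)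
  then have "?f absolutely_integrable_on (g ` S) \<and>
      integral (g ` S) ?f = vec (integral S (\<lambda>x. \<bar>det (B x)\<bar> * f (g x)))"
    by (subst (asm) has_absolute_integral_change_of_variables[OF S der inj])
  then show "f absolutely_integrable_on (g ` S)"
    and "integral (g ` S) f = integral S (\<lambda>x. \<bar>det (B x)\<bar> * f (g x))"
    by (simp_all add: absolutely_integrable_on_1_iff integral_on_1_eq vec_eq_iff)
qed

text \<open>Continuity gives measurability, and \<open>B\<close> on a ball dominates. In the
  applications \<open>S\<close> is \<open>- {0}\<close> and \<open>f\<close> may be discontinuous at
  the origin, hence the explicit bound instead of compactness.\<close>

lemma absolutely_integrable_continuous_bounded_support:
  fixes f :: "'a::euclidean_space \<Rightarrow> real"
  assumes cont: "continuous_on S f" and S: "S \<in> sets lebesgue"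
    and bound: "\<And>x. x \<in> S \<Longrightarrow> norm x \<le> R \<Longrightarrow> \<bar>f x\<bar> \<le> B"
    and supp: "\<And>x. x \<in> S \<Longrightarrow> norm x > R \<Longrightarrow> f x = 0"
  shows "f absolutely_integrable_on S"
proof (rule measurable_bounded_by_integrable_imp_absolutely_integrable)
  show "f \<in> borel_measurable (lebesgue_on S)"
    by (rule continuous_imp_measurable_on_sets_lebesgue[OF cont S])
  have "(\<lambda>x. if x \<in> cball 0 R then B else 0) integrable_on S"
  proof -
    have "S \<inter> cball 0 R \<in> lmeasurable"
      using S by (intro bounded_set_imp_lmeasurable) (auto simp: bounded_Int)
    then have "(\<lambda>x. B) integrable_on (S \<inter> cball 0 R)"
      by (simp add: integrable_on_const)
    then show ?thesis
      by (subst integrable_restrict_Int) (simp add: Int_commute)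
  qed
  then show "(\<lambda>x. if x \<in> cball 0 R then B else 0) integrable_on S" .
  show "norm (f x) \<le> (if x \<in> cball 0 R then B else 0)" if "x \<in> S" for x
    using bound[OF that] supp[OF that] by auto
qed (fact S)

text \<open>By continuity \<open>f\<close> stays above \<open>f a / 2\<close> on a small ball inside
  \<open>S\<close>, and this ball has positive volume.\<close>

lemma integral_pos_open:
  fixes f :: "'a::euclidean_space \<Rightarrow> real"
  assumes S: "open S" and cont: "continuous_on S f" and int: "f absolutely_integrable_on S"
    and nn: "\<And>x. x \<in> S \<Longrightarrow> 0 \<le> f x" and a: "a \<in> S" "0 < f a"
  shows "0 < integral S f"
proof -
  have "isCont f a"
    using S cont a continuous_on_eq_continuous_at by blast
  then have "\<forall>\<^sub>F x in at a. f a / 2 < f x"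
    using a by (intro order_tendstoD) (auto simp: isCont_def)
  then obtain d where d: "d > 0" "\<And>x. x \<noteq> a \<Longrightarrow> dist x a < d \<Longrightarrow> f a / 2 < f x"
    unfolding eventually_at by blast
  obtain r where r: "r > 0" "ball a r \<subseteq> S"
    using S a open_contains_ball by blast
  define s where "s = min d r"
  have s: "s > 0" "ball a s \<subseteq> S"
    using d r by (auto simp: s_def)
  have fs: "f a / 2 \<le> f x" if "x \<in> ball a s" for x
    using d(2)[of x] a that by (cases "x = a") (auto simp: s_def dist_commute)
  have fb: "f integrable_on ball a s"
    using set_integrable_subset[OF int _ s(2)] set_lebesgue_integral_eq_integral(1) by auto
  have "0 < f a / 2 * measure lborel (ball a s)"
    using a s by (simp add: content_ball_pos)
  also have "\<dots> = integral (ball a s) (\<lambda>x. f a / 2 * 1)"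
    by (simp only: integral_mult_right lmeasure_integral[OF lmeasurable_ball, symmetric])
      (simp add: measure_completion)
  also have "\<dots> \<le> integral (ball a s) f"
    using fs fb by (intro integral_le) (auto simp: integrable_on_const)
  also have "\<dots> \<le> integral S f"
    using fb int nn s set_lebesgue_integral_eq_integral(1) by (intro integral_subset_le) auto
  finally show ?thesis .
qed

section \<open>Monge-Ampere potentials\<close>

text \<open>A decreasing cut-off supported in \<open>s \<le> 1\<close>. The square makes it
  differentiable with derivative \<open>- 2 * max 0 (1 - s)\<close>, so that it has a first-order
  expansion with quadratic error.\<close>

definition bump :: "real \<Rightarrow> real" where
  "bump s = (max 0 (1 - s))\<^sup>2"

lemma continuous_on_bump [continuous_intros]:
  "continuous_on S f \<Longrightarrow> continuous_on S (\<lambda>x. bump (f x))"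
  unfolding bump_def by (intro continuous_intros)

lemma bump_nonneg: "0 \<le> bump s"
  and bump_le_1: "0 \<le> s \<Longrightarrow> bump s \<le> 1"
  and bump_eq_0: "1 \<le> s \<Longrightarrow> bump s = 0"
  by (auto simp: bump_def power_le_one)

lemma bump_antimono: "s \<le> s' \<Longrightarrow> bump s' \<le> bump s"
  unfolding bump_def by (intro power_mono) auto

text \<open>For \<open>u + z \<le> 1\<close> one has
  \<open>0 \<le> 1 - u - z \<le> max 0 (1 - u) - z\<close>, and squaring preserves this; otherwise
  the left side is 0. Expanding the square gives the Taylor polynomial of \<open>bump\<close> with
  error \<open>z\<^sup>2\<close>.\<close>

lemma bump_quadratic_upper: "bump (u + z) \<le> bump u - 2 * max 0 (1 - u) * z + z\<^sup>2"
proof -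
  have "bump (u + z) \<le> (max 0 (1 - u) - z)\<^sup>2"
  proof (cases "u + z \<le> 1")
    case True
    then show ?thesis
      unfolding bump_def by (intro power_mono) auto
  qed (simp add: bump_eq_0)
  then show ?thesis
    by (simp add: bump_def power2_diff)
qed

text \<open>\<open>M\<close> and \<open>D\<close> stand for the gradient and the Hessian of
  \<open>G\<close>, prescribed only off the origin, where a homogeneous function may fail to be
  twice differentiable. The density \<open>w\<close> may vanish on the axis through
  \<open>e\<close>, as happens in the supercritical case.\<close>

locale monge_ampere_potential =
  fixes G :: "real^'m \<Rightarrow> real" and M :: "real^'m \<Rightarrow> real^'m" and D :: "real^'m \<Rightarrow> real^'m^'m"
    and \<beta> :: real and w :: "real^'m \<Rightarrow> real" and e :: "real^'m"
  assumes beta: "2 \<le> \<beta>"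
    and G_0: "G 0 = 0" and M_0: "M 0 = 0"
    and G_pos: "x \<noteq> 0 \<Longrightarrow> 0 < G x"
    and G_hom: "0 < s \<Longrightarrow> G (s *\<^sub>R x) = s powr \<beta> * G x"
    and M_hom: "0 < s \<Longrightarrow> M (s *\<^sub>R x) = s powr (\<beta> - 1) *\<^sub>R M x"
    and G_der: "x \<noteq> 0 \<Longrightarrow> (G has_derivative (\<lambda>v. M x \<bullet> v)) (at x)"
    and M_der: "x \<noteq> 0 \<Longrightarrow> (M has_derivative (\<lambda>v. D x *v v)) (at x)"
    and D_psd: "x \<noteq> 0 \<Longrightarrow> 0 \<le> v \<bullet> (D x *v v)"
    and D_det: "x \<noteq> 0 \<Longrightarrow> det (D x) = (\<beta> - 1) * w x"
    and w_nonneg: "x \<noteq> 0 \<Longrightarrow> 0 \<le> w x"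
    and w_pos: "x \<notin> span {e} \<Longrightarrow> 0 < w x"
begin

section \<open>Euler's identity, convexity and Young's inequality\<close>

lemma G_nonneg: "0 \<le> G x"
  using G_pos[of x] G_0 by (cases "x = 0") auto

lemma euler: "M x \<bullet> x = \<beta> * G x"
proof (cases "x = 0")
  case False
  have "(G has_derivative (\<lambda>v. M x \<bullet> v)) (at (1 *\<^sub>R x))"
    using G_der[OF False] by simp
  then have "((\<lambda>s. G (s *\<^sub>R x)) has_derivative (\<lambda>v. M x \<bullet> (v *\<^sub>R x))) (at 1)"
    by (rule has_derivative_compose[rotated]) (auto intro!: derivative_eq_intros)
  then have 1: "((\<lambda>s. G (s *\<^sub>R x)) has_real_derivative M x \<bullet> x) (at 1)"
    by (rule has_derivative_imp_has_field_derivative) simp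
  have "((\<lambda>s. s powr \<beta> * G x) has_real_derivative \<beta> * G x) (at 1)"
    by (auto intro!: derivative_eq_intros)
  then have "((\<lambda>s. G (s *\<^sub>R x)) has_real_derivative \<beta> * G x) (at 1)"
    by (rule has_field_derivative_transform_within_open[of _ _ _ "{0<..}"]) (auto simp: G_hom)
  with 1 show ?thesis
    by (rule DERIV_unique)
qed (simp add: G_0)

lemma euler_nonneg: "0 \<le> M x \<bullet> x"
  using euler G_nonneg beta by simp

lemma segment_derivs:
  assumes "x + s *\<^sub>R v \<noteq> 0"
  shows "((\<lambda>s. G (x + s *\<^sub>R v)) has_real_derivative M (x + s *\<^sub>R v) \<bullet> v) (at s)"
    and "((\<lambda>s. M (x + s *\<^sub>R v) \<bullet> v) has_real_derivative v \<bullet> (D (x + s *\<^sub>R v) *v v)) (at s)"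
    and "((\<lambda>s. M (x + s *\<^sub>R v)) has_vector_derivative (D (x + s *\<^sub>R v) *v v)) (at s)"
proof -
  have l: "((\<lambda>s. x + s *\<^sub>R v) has_derivative (\<lambda>t. t *\<^sub>R v)) (at s)"
    by (auto intro!: derivative_eq_intros)
  show "((\<lambda>s. G (x + s *\<^sub>R v)) has_real_derivative M (x + s *\<^sub>R v) \<bullet> v) (at s)"
    by (rule has_derivative_imp_has_field_derivative[OF has_derivative_compose[OF l G_der[OF assms]]]) simp
  have d: "((\<lambda>s. M (x + s *\<^sub>R v)) has_derivative (\<lambda>t. D (x + s *\<^sub>R v) *v (t *\<^sub>R v))) (at s)"
    by (rule has_derivative_compose[OF l M_der[OF assms]])
  show "((\<lambda>s. M (x + s *\<^sub>R v) \<bullet> v) has_real_derivative v \<bullet> (D (x + s *\<^sub>R v) *v v)) (at s)"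
    by (rule has_derivative_imp_has_field_derivative[OF has_derivative_inner_left[OF d]])
      (simp add: matrix_vector_mult_scaleR inner_commute)
  show "((\<lambda>s. M (x + s *\<^sub>R v)) has_vector_derivative (D (x + s *\<^sub>R v) *v v)) (at s)"
    using d by (simp add: has_vector_derivative_def matrix_vector_mult_scaleR)
qed

text \<open>If the segment from \<open>x\<close> to \<open>z\<close> avoids the origin, the
  derivative of \<open>G\<close> along it is nondecreasing because the Hessian is positive
  semidefinite, and the mean value theorem applies. If it meets the origin and
  \<open>x \<noteq> 0\<close>, then \<open>z\<close> is a nonpositive multiple of \<open>x\<close>
  and Euler's identity makes the left side nonpositive.\<close>

lemma subgradient: "G x + M x \<bullet> (z - x) \<le> G z"
proof (cases "\<exists>s\<in>{0..1}. x + s *\<^sub>R (z - x) = 0")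
  case True
  then obtain s where s: "0 \<le> s" "s \<le> 1" and eq: "x + s *\<^sub>R (z - x) = 0"
    by auto
  show ?thesis
  proof (cases "x = 0")
    case True
    then show ?thesis
      using G_nonneg G_0 M_0 by simp
  next
    case False
    with eq s have "s > 0" by (cases "s = 0") auto
    have "s *\<^sub>R (z - x) = - x"
      using eq by (simp add: add_eq_0_iff)
    then have "inverse s *\<^sub>R s *\<^sub>R (z - x) = inverse s *\<^sub>R (- x)"
      by simp
    then have zx: "z - x = (- 1 / s) *\<^sub>R x"
      using \<open>s > 0\<close> by (simp add: inverse_eq_divide)
    have "G x + M x \<bullet> (z - x) = G x - \<beta> * G x / s"
      by (simp add: zx euler)
    also have "\<dots> \<le> G x - 1 * G x / 1"
      using beta G_nonneg s \<open>s > 0\<close> by (intro diff_left_mono frac_le mult_right_mono) auto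
    finally show ?thesis
      using G_nonneg[of z] by simp
  qed
next
  case False
  then have ne: "x + s *\<^sub>R (z - x) \<noteq> 0" if "0 \<le> s" "s \<le> 1" for s
    using that by auto
  let ?v = "z - x"
  obtain s where s: "0 < s" "s < 1"
    and *: "G (x + 1 *\<^sub>R ?v) - G (x + 0 *\<^sub>R ?v) = (1 - 0) * (M (x + s *\<^sub>R ?v) \<bullet> ?v)"
    using MVT2[of 0 1 "\<lambda>s. G (x + s *\<^sub>R ?v)" "\<lambda>s. M (x + s *\<^sub>R ?v) \<bullet> ?v"] segment_derivs(1)[OF ne]
    by (metis zero_less_one)
  have "M (x + 0 *\<^sub>R ?v) \<bullet> ?v \<le> M (x + s *\<^sub>R ?v) \<bullet> ?v"
  proof (rule DERIV_nonneg_imp_nondecreasing[where f = "\<lambda>s. M (x + s *\<^sub>R ?v) \<bullet> ?v"])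
    fix r assume "0 \<le> r" "r \<le> s"
    then have "x + r *\<^sub>R ?v \<noteq> 0" using ne s by simp
    from segment_derivs(2)[OF this] D_psd[OF this]
    show "\<exists>y. ((\<lambda>s. M (x + s *\<^sub>R ?v) \<bullet> ?v) has_real_derivative y) (at r) \<and> 0 \<le> y"
      by blast
  qed (use s in simp)
  with * show ?thesis by simp
qed

text \<open>By Euler's identity \<open>(\<beta> - 1) * G z\<close> is the value of the Legendre
  conjugate of \<open>G\<close> at \<open>M z\<close>, so this is Young's inequality with the
  conjugate written in terms of \<open>G\<close>.\<close>

lemma young: "M z \<bullet> x \<le> G x + (\<beta> - 1) * G z"
  using subgradient[of z x] euler[of z] by (simp add: inner_diff_right algebra_simps)

section \<open>Injectivity of the gradient map\<close>

lemma gradient_eqI: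
  assumes "z \<noteq> 0" and "\<And>u. G z + p \<bullet> (u - z) \<le> G u"
  shows "M z = p"
proof -
  have "((\<lambda>u. G u - p \<bullet> u) has_derivative (\<lambda>v. M z \<bullet> v - p \<bullet> v)) (at z)"
    by (intro derivative_intros G_der assms)
  moreover have "\<forall>\<^sub>F u in at z. G z - p \<bullet> z \<le> G u - p \<bullet> u"
    using assms(2) by (intro always_eventually) (auto simp: inner_diff_right algebra_simps)
  ultimately have "(\<lambda>v. M z \<bullet> v - p \<bullet> v) = (\<lambda>v. 0)"
    using has_derivative_local_min by blast
  then have "(M z - p) \<bullet> (M z - p) = 0"
    by (metis inner_diff_left)
  then show ?thesis by simp
qed

lemma M_nonzero: "x \<noteq> 0 \<Longrightarrow> M x \<noteq> 0"
  using euler[of x] G_pos[of x] beta by auto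

text \<open>For parallel points Euler's identity excludes opposite directions, and homogeneity of
  positive degree \<open>\<beta> - 1\<close> separates points of one ray. Otherwise equal gradients
  make \<open>G\<close> affine on the segment; its gradient is constant there, so the Hessian
  annihilates the direction of the segment, which contradicts its nonzero determinant off the
  axis.\<close>

lemma inj_M: "inj_on M (- {0})"
proof (rule inj_onI)
  fix x y assume x: "x \<in> - {0}" and y: "y \<in> - {0}" and eq: "M x = M y"
  let ?v = "y - x" and ?l = "\<lambda>s. x + s *\<^sub>R (y - x)"
  show "x = y"
  proof (cases "\<exists>c. y = c *\<^sub>R x")
    case True
    then obtain c where c: "y = c *\<^sub>R x" by auto
    have "0 < M y \<bullet> y"
      using euler[of y] G_pos[of y] y beta by auto
    also have "M y \<bullet> y = c * (M x \<bullet> x)"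
      by (simp add: c[symmetric] eq) (simp add: c)
    finally have "0 < c"
      using euler_nonneg[of x] by (auto simp: zero_less_mult_iff)
    then have "c powr (\<beta> - 1) *\<^sub>R M x = M x"
      using eq M_hom[of c x] c by simp
    then have "c powr (\<beta> - 1) = 1"
      using M_nonzero[of x] x by (metis ComplD insertI1 scaleR_cancel_right scaleR_one)
    then have "c = 1"
      using \<open>0 < c\<close> beta powr_eq_one_iff_gen[of c "\<beta> - 1"] by auto
    then show ?thesis using c by simp
  next
    case False
    have ne: "?l s \<noteq> 0" for s
    proof
      assume "?l s = 0"
      then have 0: "s *\<^sub>R y = (s - 1) *\<^sub>R x"
        by (simp add: algebra_simps)
      then have "s \<noteq> 0" using x by auto
      have "y = inverse s *\<^sub>R s *\<^sub>R y"
        using \<open>s \<noteq> 0\<close> by simp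
      also have "\<dots> = (inverse s * (s - 1)) *\<^sub>R x"
        by (simp only: 0 scaleR_scaleR)
      finally show False
        using False by blast
    qed
    \<comment> \<open>The lower bound is the supporting plane at \<open>x\<close>. The upper bound
      is convexity along the chord, whose slope is at most that of the plane because
      \<open>M y = M x\<close>.\<close>
    have G_seg: "G (?l s) = G x + M x \<bullet> (?l s - x)" if s: "0 \<le> s" "s \<le> 1" for s
    proof (rule antisym)
      show "G x + M x \<bullet> (?l s - x) \<le> G (?l s)"
        by (rule subgradient)
      have 1: "G (?l s) + M (?l s) \<bullet> (x - ?l s) \<le> G x"
        and 2: "G (?l s) + M (?l s) \<bullet> (y - ?l s) \<le> G y"
        and 3: "G y + M y \<bullet> (x - y) \<le> G x"
        by (rule subgradient)+
      have "(1 - s) * (G (?l s) + M (?l s) \<bullet> (x - ?l s)) + s * (G (?l s) + M (?l s) \<bullet> (y - ?l s))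
          \<le> (1 - s) * G x + s * G y"
        using 1 2 s by (intro add_mono mult_left_mono) auto
      also have "(1 - s) * (G (?l s) + M (?l s) \<bullet> (x - ?l s)) + s * (G (?l s) + M (?l s) \<bullet> (y - ?l s))
          = G (?l s) + M (?l s) \<bullet> ((1 - s) *\<^sub>R (x - ?l s) + s *\<^sub>R (y - ?l s))"
        by (simp add: inner_add_right algebra_simps)
      also have "(1 - s) *\<^sub>R (x - ?l s) + s *\<^sub>R (y - ?l s) = 0"
        by (simp add: algebra_simps)
      finally have "G (?l s) \<le> (1 - s) * G x + s * G y" by simp
      also have "\<dots> \<le> (1 - s) * G x + s * (G x + M x \<bullet> (y - x))"
        using 3 s by (intro add_mono mult_left_mono) (auto simp: eq inner_diff_right)
      finally show "G (?l s) \<le> G x + M x \<bullet> (?l s - x)"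
        by (simp add: algebra_simps)
    qed
    have M_seg: "M (?l s) = M x" if s: "0 \<le> s" "s \<le> 1" for s
    proof (rule gradient_eqI[OF ne])
      fix u show "G (?l s) + M x \<bullet> (u - ?l s) \<le> G u"
        using subgradient[of x u] by (simp add: G_seg[OF s] inner_diff_right inner_add_right)
    qed
    have D0: "D (?l s) *v ?v = 0" if s: "0 < s" "s < 1" for s
    proof -
      have "((\<lambda>s. M x) has_vector_derivative 0) (at s)"
        by simp
      then have "((\<lambda>s. M (?l s)) has_vector_derivative 0) (at s)"
        by (rule has_vector_derivative_transform_within_open[of _ _ _ "{0<..<1}"])
          (use s in \<open>auto simp: M_seg\<close>)
      with segment_derivs(3)[OF ne] show ?thesis
        by (rule vector_derivative_unique_at)
    qed
    \<comment> \<open>Two interior points on the axis would put both endpoints on it by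
      extrapolation, and the endpoints would be parallel.\<close>
    have "\<exists>s. 0 < s \<and> s < 1 \<and> ?l s \<notin> span {e}"
    proof (rule ccontr)
      assume "\<not> ?thesis"
      then have "?l s \<in> span {e}" if "0 < s" "s < 1" for s
        using that by blast
      from this[of "1/3"] this[of "2/3"] have "?l (1/3) \<in> span {e}" "?l (2/3) \<in> span {e}"
        by simp_all
      then have 1: "2 *\<^sub>R ?l (1/3) - ?l (2/3) \<in> span {e}" and 2: "2 *\<^sub>R ?l (2/3) - ?l (1/3) \<in> span {e}"
        by (auto intro!: span_diff span_mul)
      have "2 *\<^sub>R ?l (1/3) - ?l (2/3) = x" "2 *\<^sub>R ?l (2/3) - ?l (1/3) = y"
        by (auto simp: vec_eq_iff algebra_simps)
      with 1 2 obtain a b where ab: "x = a *\<^sub>R e" "y = b *\<^sub>R e"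
        by (auto simp: span_singleton)
      then have "y = (b / a) *\<^sub>R x"
        using x by auto
      with False show False by blast
    qed
    then obtain s where s: "0 < s" "s < 1" "?l s \<notin> span {e}" by blast
    then have "det (D (?l s)) \<noteq> 0"
      using D_det[OF ne] w_pos[OF s(3)] beta by simp
    then have "invertible (D (?l s))"
      by (simp add: invertible_det_nz)
    then have "?v = 0"
      using D0[OF s(1,2)] by (metis matrix_left_invertible_ker invertible_left_inverse)
    then show ?thesis by simp
  qed
qed

section \<open>Growth bounds by compactness of the sphere and homogeneity\<close>

lemma G_cont: "continuous_on (- {0}) G"
  by (rule continuous_at_imp_continuous_on) (auto intro: has_derivative_continuous G_der)

lemma M_cont: "continuous_on (- {0}) M"
  by (rule continuous_at_imp_continuous_on) (auto intro: has_derivative_continuous M_der)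

lemma G_lower_bound: obtains c where "0 < c" "\<And>x. c * norm x powr \<beta> \<le> G x"
proof -
  have "\<exists>u\<in>sphere 0 1. \<forall>v\<in>sphere 0 1. G u \<le> G v"
    by (intro continuous_attains_inf continuous_on_subset[OF G_cont]) auto
  then obtain u where u: "norm u = 1" "\<And>v. norm v = 1 \<Longrightarrow> G u \<le> G v"
    by auto
  have "G u * norm x powr \<beta> \<le> G x" for x
  proof (cases "x = 0")
    case False
    have "G u * norm x powr \<beta> \<le> G (x /\<^sub>R norm x) * norm x powr \<beta>"
      using False by (intro mult_right_mono u) auto
    also have "\<dots> = G x"
      using G_hom[of "norm x" "x /\<^sub>R norm x"] False by simp
    finally show ?thesis .
  qed (simp add: G_0)
  moreover have "0 < G u"
    using u(1) G_pos[of u] by force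
  ultimately show ?thesis using that by blast
qed

lemma G_upper_bound: obtains C where "0 < C" "\<And>x. G x \<le> C * norm x powr \<beta>"
proof -
  have "\<exists>u\<in>sphere 0 1. \<forall>v\<in>sphere 0 1. G v \<le> G u"
    by (intro continuous_attains_sup continuous_on_subset[OF G_cont]) auto
  then obtain u where u: "norm u = 1" "\<And>v. norm v = 1 \<Longrightarrow> G v \<le> G u"
    by auto
  have "G x \<le> G u * norm x powr \<beta>" for x
  proof (cases "x = 0")
    case False
    have "G x = G (x /\<^sub>R norm x) * norm x powr \<beta>"
      using G_hom[of "norm x" "x /\<^sub>R norm x"] False by simp
    also have "\<dots> \<le> G u * norm x powr \<beta>"
      using False by (intro mult_right_mono u) auto
    finally show ?thesis .
  qed (simp add: G_0)
  moreover have "0 < G u"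
    using u(1) G_pos[of u] by force
  ultimately show ?thesis using that by blast
qed

lemma M_upper_bound: obtains C where "0 < C" "\<And>x. norm (M x) \<le> C * norm x powr (\<beta> - 1)"
proof -
  have "compact (M ` sphere 0 1)"
    by (intro compact_continuous_image continuous_on_subset[OF M_cont]) auto
  then obtain C where C: "0 < C" "\<And>u. norm u = 1 \<Longrightarrow> norm (M u) \<le> C"
    using compact_imp_bounded[THEN bounded_pos[THEN iffD1]] by force
  have "norm (M x) \<le> C * norm x powr (\<beta> - 1)" for x
  proof (cases "x = 0")
    case False
    have "norm (M x) = norm x powr (\<beta> - 1) * norm (M (x /\<^sub>R norm x))"
      using M_hom[of "norm x" "x /\<^sub>R norm x"] False by simp
    also have "\<dots> \<le> norm x powr (\<beta> - 1) * C"
      using False by (intro mult_left_mono C) auto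
    finally show ?thesis by (simp add: mult.commute)
  qed (simp add: M_0)
  with C(1) show ?thesis using that by blast
qed

lemma G_continuous: "continuous_on UNIV G"
proof -
  obtain C where C: "\<And>x. G x \<le> C * norm x powr \<beta>"
    using G_upper_bound by blast
  have "((\<lambda>x. C * norm x powr \<beta>) \<longlongrightarrow> 0) (at 0)"
    using beta by (auto intro!: tendsto_eq_intros simp: tendsto_norm_zero_iff)
  then have "(G \<longlongrightarrow> 0) (at 0)"
    by (rule tendsto_sandwich[OF _ _ tendsto_const, rotated 2]) (auto simp: G_nonneg C)
  then have "isCont G 0"
    by (simp add: isCont_def G_0)
  moreover have "isCont G x" if "x \<noteq> 0" for x
    using has_derivative_continuous[OF G_der[OF that]] .
  ultimately show ?thesis
    by (metis continuous_at_imp_continuous_on)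
qed

section \<open>Surjectivity of the gradient map and its inverse\<close>

lemma sq_le_powr_beta: "1 \<le> a \<Longrightarrow> a\<^sup>2 \<le> a powr \<beta>"
  using powr_mono[OF beta, of a] by (simp add: powr_numeral)

text \<open>A preimage of \<open>y\<close> is a minimiser of \<open>G x - y \<bullet> x\<close>: a
  minimum exists because \<open>G\<close> grows at least quadratically, and it is not at the origin
  because \<open>G\<close> vanishes there to at least second order while the linear term is negative
  in direction \<open>y\<close>.\<close>

lemma surj_M: "M ` (- {0}) = - {0}"
proof (intro antisym subsetI)
  fix y :: "real^'m" assume "y \<in> - {0}"
  then have y: "y \<noteq> 0" by simp
  obtain c where c: "0 < c" "\<And>x. c * norm x powr \<beta> \<le> G x"
    using G_lower_bound by blast
  \<comment> \<open>Beyond radius \<open>\<rho>\<close> one has both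
    \<open>norm y < c * norm x\<close> and \<open>norm x \<ge> 1\<close>, so \<open>G\<close>
    dominates the linear term.\<close>
  define \<rho> where "\<rho> = 1 + norm y / c"
  have \<rho>: "1 \<le> \<rho>" using c by (simp add: \<rho>_def)
  let ?F = "\<lambda>x. G x - y \<bullet> x"
  have out: "0 < ?F x" if "norm x > \<rho>" for x
  proof -
    have "norm y < c * norm x"
      using that c by (simp add: \<rho>_def field_simps)
    then have "norm y * norm x < c * norm x * norm x"
      using that \<rho> by (intro mult_strict_right_mono) auto
    also have "\<dots> \<le> c * norm x powr \<beta>"
      using sq_le_powr_beta[of "norm x"] that \<rho> c by (simp add: power2_eq_square mult.assoc)
    also have "\<dots> \<le> G x" by (rule c)
    finally show ?thesis
      using norm_cauchy_schwarz[of y x] by simp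
  qed
  have "\<exists>x\<in>cball 0 \<rho>. \<forall>z\<in>cball 0 \<rho>. ?F x \<le> ?F z"
    using \<rho> by (intro continuous_attains_inf continuous_intros continuous_on_subset[OF G_continuous]) auto
  then obtain x where x: "norm x \<le> \<rho>" "\<And>z. norm z \<le> \<rho> \<Longrightarrow> ?F x \<le> ?F z"
    by auto
  have min: "?F x \<le> ?F z" for z
  proof (cases "norm z \<le> \<rho>")
    case False
    have "?F x \<le> ?F 0" using x(2)[of 0] \<rho> by simp
    also have "\<dots> \<le> ?F z" using out[of z] False by (simp add: G_0)
    finally show ?thesis .
  qed (fact x(2))
  have "x \<noteq> 0"
  proof
    assume "x = 0"
    \<comment> \<open>Small enough that \<open>G (t *\<^sub>R y) \<le> t\<^sup>2 * G y\<close> is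
      less than \<open>t * (y \<bullet> y)\<close>; the factor 2 makes the inequality
      strict.\<close>
    define t where "t = min 1 (y \<bullet> y / (2 * G y))"
    have yy: "0 < y \<bullet> y" "0 < G y" using y G_pos by auto
    then have t: "0 < t" "t \<le> 1" "t * G y < y \<bullet> y"
      by (auto simp: t_def min_def field_simps)
    have "t powr \<beta> \<le> t powr 2"
      using t beta by (intro powr_mono') auto
    then have "t powr \<beta> * G y \<le> t\<^sup>2 * G y"
      using t yy by (simp add: powr_numeral)
    also have "\<dots> < t * (y \<bullet> y)"
      using t by (simp add: power2_eq_square mult.assoc)
    finally have "?F (t *\<^sub>R y) < 0"
      using t by (simp add: G_hom)
    with min[of "t *\<^sub>R y"] \<open>x = 0\<close> show False by (simp add: G_0)
  qed
  have "M x = y"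
  proof (rule gradient_eqI[OF \<open>x \<noteq> 0\<close>])
    show "G x + y \<bullet> (u - x) \<le> G u" for u
      using min[of u] by (simp add: inner_diff_right)
  qed
  then show "y \<in> M ` (- {0})"
    using \<open>x \<noteq> 0\<close> by auto
qed (use M_nonzero in auto)

text \<open>Off the origin this is the gradient of the Legendre conjugate of
  \<open>G\<close>.\<close>

definition M_inv :: "real^'m \<Rightarrow> real^'m" where
  "M_inv = inv_into (- {0}) M"

lemma M_inv: "y \<noteq> 0 \<Longrightarrow> M_inv y \<noteq> 0" "y \<noteq> 0 \<Longrightarrow> M (M_inv y) = y" "x \<noteq> 0 \<Longrightarrow> M_inv (M x) = x"
  unfolding M_inv_def
  using inv_into_into[of y M "- {0}"] f_inv_into_f[of y M "- {0}"] inv_into_f_f[OF inj_M, of x]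
  by (auto simp: surj_M)

lemma bump_G_support: obtains \<rho> where "1 \<le> \<rho>" "\<And>x. \<rho> < norm x \<Longrightarrow> bump (G x) = 0"
proof -
  obtain c where c: "0 < c" "\<And>x. c * norm x powr \<beta> \<le> G x"
    using G_lower_bound by blast
  have "bump (G x) = 0" if x: "1 + 1 / c < norm x" for x
  proof (rule bump_eq_0)
    have 1: "1 \<le> norm x"
      using x c by (smt (verit) divide_pos_pos)
    have "1 \<le> c * norm x"
      using x c by (simp add: field_simps)
    also have "\<dots> \<le> c * norm x powr \<beta>"
      using 1 sq_le_powr_beta[OF 1] c self_le_power[OF 1, of 2] by (intro mult_left_mono) auto
    also have "\<dots> \<le> G x" by (rule c)
    finally show "1 \<le> G x" .
  qed
  then show ?thesis
    using that[of "1 + 1 / c"] c by auto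
qed

text \<open>For \<open>x = M_inv y\<close> of norm above 1, the chain \<open>c * (norm x)\<^sup>2
  \<le> G x \<le> \<beta> * G x = y \<bullet> x \<le> R * norm x\<close> bounds
  \<open>norm x\<close>.\<close>

lemma M_inv_bounded: obtains X where "0 < X" "\<And>y. y \<noteq> 0 \<Longrightarrow> norm y \<le> R \<Longrightarrow> norm (M_inv y) \<le> X"
proof -
  obtain c where c: "0 < c" "\<And>x. c * norm x powr \<beta> \<le> G x"
    using G_lower_bound by blast
  have "norm (M_inv y) \<le> 1 + \<bar>R\<bar> / c" if y: "y \<noteq> 0" "norm y \<le> R" for y
  proof (cases "norm (M_inv y) \<le> 1")
    case False
    let ?x = "M_inv y"
    have "c * (norm ?x)\<^sup>2 \<le> c * norm ?x powr \<beta>"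
      using False c sq_le_powr_beta[of "norm ?x"] by simp
    also have "\<dots> \<le> 1 * G ?x" using c by simp
    also have "\<dots> \<le> \<beta> * G ?x"
      using beta G_nonneg by (intro mult_right_mono) auto
    also have "\<dots> = y \<bullet> ?x"
      using euler[of ?x] M_inv(2)[OF y(1)] by simp
    also have "\<dots> \<le> R * norm ?x"
      using norm_cauchy_schwarz[of y ?x] y by (meson mult_right_mono norm_ge_zero order_trans)
    finally have "(c * norm ?x) * norm ?x \<le> R * norm ?x"
      by (simp add: power2_eq_square mult.assoc)
    then have "c * norm ?x \<le> R"
      using False by (subst (asm) mult_le_cancel_right) auto
    then show ?thesis
      using c by (simp add: field_simps)
  qed (use c in \<open>simp add: add_increasing2\<close>)
  with c show ?thesis
    using that[of "1 + \<bar>R\<bar> / c"] by (simp add: add_pos_nonneg)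
qed

text \<open>The increment \<open>d\<close> of the Legendre conjugate enters with opposite signs on the two sides,
  so its first-order contribution cancels.\<close>
lemma bump_conjugate:
  assumes d: "G x - d \<le> G x'" "(\<beta> - 1) * (G z - G x) = d"
  shows "bump (G x') + (\<beta> - 1) * bump (G z) \<le> \<beta> * bump (G x) + 2 * d\<^sup>2"
proof -
  define m where "m = max 0 (1 - G x)"
  define k where "k = \<beta> - 1"
  have k: "1 \<le> k" using beta by (simp add: k_def)
  have "bump (G x') \<le> bump (G x + (- d))"
    using d(1) by (intro bump_antimono) simp
  also have "\<dots> \<le> bump (G x) + 2 * m * d + d\<^sup>2"
    using bump_quadratic_upper[of "G x" "- d"] by (simp add: m_def)
  finally have 1: "bump (G x') \<le> bump (G x) + 2 * m * d + d\<^sup>2" .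
  have "G z = G x + d / k"
    using d(2) k by (simp add: k_def field_simps)
  then have "k * bump (G z) \<le> k * (bump (G x) - 2 * m * (d / k) + (d / k)\<^sup>2)"
    using bump_quadratic_upper[of "G x" "d / k"] k by (simp add: m_def)
  also have "\<dots> = k * bump (G x) - 2 * m * d + d\<^sup>2 / k"
    using k by (simp add: algebra_simps power2_eq_square)
  also have "d\<^sup>2 / k \<le> d\<^sup>2 / 1"
    using k by (intro divide_left_mono) auto
  finally show ?thesis
    using 1 by (simp add: k_def algebra_simps)
qed

end

section \<open>The integrated second-order estimate\<close>

locale monge_ampere_potential_continuous = monge_ampere_potential G M D \<beta> w e
  for G :: "real^'m::{finite,wellorder} \<Rightarrow> real" and M :: "real^'m::_ \<Rightarrow> real^'m::_"
    and D :: "real^'m::_ \<Rightarrow> real^'m::_^'m::_" and \<beta> w e +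
  assumes w_cont: "continuous_on (- {0}) w"
    and w_bounded: "\<exists>B. \<forall>x. x \<noteq> 0 \<longrightarrow> norm x \<le> R \<longrightarrow> w x \<le> B"
begin

lemma bump_w_integrable:
  assumes "continuous_on UNIV f" "\<And>x. norm x > R \<Longrightarrow> bump (f x) = 0" "\<And>x. 0 \<le> f x"
  shows "(\<lambda>x. bump (f x) * w x) absolutely_integrable_on - {0}"
proof -
  obtain B where B: "\<And>x. x \<noteq> 0 \<Longrightarrow> norm x \<le> R \<Longrightarrow> w x \<le> B"
    using w_bounded by blast
  show ?thesis
  proof (rule absolutely_integrable_continuous_bounded_support[where R = R and B = B])
    show "continuous_on (- {0}) (\<lambda>x. bump (f x) * w x)"
      by (intro continuous_intros w_cont continuous_on_subset[OF assms(1)]) auto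
    show "\<bar>bump (f x) * w x\<bar> \<le> B" if "x \<in> - {0}" "norm x \<le> R" for x
    proof -
      have "bump (f x) * w x \<le> 1 * w x"
        using that w_nonneg[of x] by (intro mult_right_mono bump_le_1 assms) auto
      also have "\<dots> \<le> B" using that B by simp
      finally show ?thesis
        using that w_nonneg[of x] bump_nonneg by simp
    qed
  qed (use assms in auto)
qed

text \<open>The inequality \<open>bump_conjugate\<close> is integrated over all gradients
  \<open>y\<close>. Since \<open>B\<close> preserves volume, the terms at
  \<open>M_inv (B *v y)\<close> and \<open>M_inv y\<close> have the same integral, and the
  coefficients \<open>\<beta> - 1\<close> and \<open>\<beta>\<close> leave one copy of it. The error
  is of order \<open>t\<^sup>2\<close> on a fixed ball, so \<open>K\<close> depends on neither
  \<open>t\<close> nor \<open>B\<close>.\<close>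

lemma second_order_estimate:
  obtains K where
    "\<And>t B. \<lbrakk>0 \<le> t; t \<le> 1 / 2; det B = 1; transpose B = B; \<And>y. norm (B *v y - y) \<le> t * norm y\<rbrakk> \<Longrightarrow>
      (\<lambda>x. bump (G x) * (w (B *v x) - w x)) absolutely_integrable_on - {0} \<and>
      integral (- {0}) (\<lambda>x. bump (G x) * (w (B *v x) - w x)) \<le> K * t\<^sup>2"
proof -
  obtain \<rho> where \<rho>: "1 \<le> \<rho>" "\<And>x. \<rho> < norm x \<Longrightarrow> bump (G x) = 0"
    using bump_G_support by blast
  obtain C where C: "0 < C" "\<And>x. norm (M x) \<le> C * norm x powr (\<beta> - 1)"
    using M_upper_bound by blast
  \<comment> \<open>Gradients of norm above \<open>R / 2\<close> come from points outside the ball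
    of radius \<open>2 * \<rho>\<close>. Hence for \<open>norm y > R\<close> both cut-offs on the
    left of the pointwise inequality vanish, even after a distortion by a factor 2.\<close>
  define R where "R = 2 * (C * (2 * \<rho>) powr (\<beta> - 1))"
  have R: "0 < R" using C \<rho> by (simp add: R_def)
  have M_small: "norm (M x) \<le> R / 2" if "norm x \<le> 2 * \<rho>" for x
  proof -
    have "norm (M x) \<le> C * norm x powr (\<beta> - 1)" by (rule C)
    also have "\<dots> \<le> R / 2"
      using that C beta by (simp add: R_def powr_mono2)
    finally show ?thesis .
  qed
  \<comment> \<open>The radius \<open>2 * R\<close> also covers \<open>B *v y\<close> for
    \<open>norm y \<le> R\<close>.\<close>
  obtain X where X: "0 < X" "\<And>y. y \<noteq> 0 \<Longrightarrow> norm y \<le> 2 * R \<Longrightarrow> norm (M_inv y) \<le> X"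
    using M_inv_bounded by blast
  define K where "K = 2 * (X * R)\<^sup>2 * measure lborel (cball (0::real^'m::_) R)"
  show ?thesis
  proof (rule that)
    fix t :: real and B :: "real^'m::_^'m::_"
    assume t: "0 \<le> t" "t \<le> 1 / 2" and detB: "det B = 1" and sym: "transpose B = B"
      and near: "\<And>y. norm (B *v y - y) \<le> t * norm y"
    have "invertible B" using detB by (simp add: invertible_det_nz)
    then obtain T where BT: "B ** T = mat 1" "T ** B = mat 1"
      by (auto simp: invertible_def)
    have BTx [simp]: "B *v (T *v x) = x" "T *v (B *v x) = x" for x
      by (simp_all add: matrix_vector_mul_assoc BT)
    \<comment> \<open>Symmetry of \<open>B\<close> makes the pairing invariant when its two
      arguments are moved by \<open>B\<close> and by its inverse; this is what matches Young's
      inequality with the equality case at \<open>x\<close>.\<close>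
    have dot: "(B *v y) \<bullet> (T *v x) = y \<bullet> x" for x y
      by (metis BTx(1) dot_lmul_matrix inner_commute sym transpose_matrix_vector)
    have Bne: "B *v y \<noteq> 0" if "y \<noteq> 0" for y
      using that BTx(2)[of y] by (metis matrix_vector_mult_0_right)
    have B_lower: "norm y \<le> 2 * norm (B *v y)" and B_upper: "norm (B *v y) \<le> 2 * norm y" for y
    proof -
      have "norm (B *v y - y) \<le> norm y / 2"
        using near[of y] t mult_right_mono[of t "1/2" "norm y"] by simp
      then show "norm y \<le> 2 * norm (B *v y)" "norm (B *v y) \<le> 2 * norm y"
        using norm_triangle_sub[of y "B *v y"] norm_triangle_sub[of "B *v y" y]
        by (simp_all add: norm_minus_commute)
    qed
    have T_lower: "norm x \<le> 2 * norm (T *v x)" for x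
      using B_upper[of "T *v x"] by simp
    let ?S = "- {0} :: (real^'m::_) set"
    have pointwise: "bump (G (T *v M_inv y)) + (\<beta> - 1) * bump (G (M_inv (B *v y)))
        \<le> \<beta> * bump (G (M_inv y)) + (if y \<in> cball 0 R then 2 * (X * R)\<^sup>2 * t\<^sup>2 else 0)"
      if "y \<in> ?S" for y
    proof -
      have y: "y \<noteq> 0" "B *v y \<noteq> 0" using that Bne by auto
      define x where "x = M_inv y"
      define z where "z = M_inv (B *v y)"
      have x: "x \<noteq> 0" "M x = y" and z: "z \<noteq> 0" "M z = B *v y"
        using y M_inv by (auto simp: x_def z_def)
      show ?thesis
      proof (cases "norm y \<le> R")
        case True
        \<comment> \<open>The increment of the Legendre conjugate from \<open>y\<close> to
          \<open>B *v y\<close>.\<close>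
        define d where "d = (\<beta> - 1) * (G z - G x)"
        have a: "G x + (\<beta> - 1) * G x = y \<bullet> x"
          using euler[of x] x by (simp add: algebra_simps)
        have c: "G z + (\<beta> - 1) * G z = (B *v y) \<bullet> z"
          using euler[of z] z by (simp add: algebra_simps)
        have "y \<bullet> x \<le> G (T *v x) + (\<beta> - 1) * G z"
          using young[of z "T *v x"] by (simp add: z dot)
        then have 1: "G x - d \<le> G (T *v x)"
          using a by (simp add: d_def algebra_simps)
        \<comment> \<open>The conjugate is convex with subgradients \<open>x\<close> at
          \<open>y\<close> and \<open>z\<close> at \<open>B *v y\<close>. Young's inequality in both
          directions therefore traps \<open>d\<close> between two pairings with
          \<open>B *v y - y\<close>, each of size at most \<open>t * (X * R)\<close>.\<close>
        have "(B *v y - y) \<bullet> x \<le> d"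
          using young[of z x] a by (simp add: z d_def inner_diff_left algebra_simps)
        moreover have "d \<le> (B *v y - y) \<bullet> z"
          using young[of x z] c by (simp add: x d_def inner_diff_left algebra_simps)
        moreover have "\<bar>(B *v y - y) \<bullet> u\<bar> \<le> t * (X * R)" if "norm u \<le> X" for u
        proof -
          have "\<bar>(B *v y - y) \<bullet> u\<bar> \<le> norm (B *v y - y) * norm u"
            by (rule Cauchy_Schwarz_ineq2)
          also have "\<dots> \<le> (t * R) * X"
            using near[of y] True t that R
            by (intro mult_mono) (auto intro: order_trans mult_left_mono)
          finally show ?thesis by (simp add: mult_ac)
        qed
        moreover have "norm x \<le> X" "norm z \<le> X"
          using X(2)[of y] X(2)[of "B *v y"] y True B_upper[of y] R by (auto simp: x_def z_def)
        ultimately have "\<bar>d\<bar> \<le> t * (X * R)"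
          by (smt (verit))
        then have "d\<^sup>2 \<le> (t * (X * R))\<^sup>2"
          using abs_le_square_iff[of d "t * (X * R)"] by simp
        then show ?thesis
          using bump_conjugate[OF 1, of z] True
          by (simp add: d_def x_def z_def power_mult_distrib mult_ac)
      next
        case False
        have "bump (G (T *v x)) = 0"
        proof (rule \<rho>)
          show "\<rho> < norm (T *v x)"
            using M_small[of x] False x T_lower[of x] R by force
        qed
        moreover have "bump (G z) = 0"
        proof (rule \<rho>)
          show "\<rho> < norm z"
            using M_small[of z] False z B_lower[of y] R \<rho> by force
        qed
        ultimately show ?thesis
          using False beta bump_nonneg[of "G x"] by (simp add: x_def z_def)
      qed
    qed
    have absdet: "\<bar>det (D x)\<bar> = (\<beta> - 1) * w x" if "x \<in> ?S" for x
      using D_det[of x] w_nonneg[of x] beta that by simp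
    have Sl: "?S \<in> sets lebesgue" by simp
    have Mder: "(M has_derivative (*v) (D x)) (at x within ?S)" if "x \<in> ?S" for x
      using M_der[of x] that by (auto intro: has_derivative_at_withinI)
    have int0: "(\<lambda>x. bump (G x) * w x) absolutely_integrable_on ?S"
      by (rule bump_w_integrable[OF G_continuous, of \<rho>]) (auto simp: \<rho> G_nonneg)
    have intT: "(\<lambda>x. bump (G (T *v x)) * w x) absolutely_integrable_on ?S"
    proof (rule bump_w_integrable[of _ "2 * \<rho>"])
      show "continuous_on UNIV (\<lambda>x. G (T *v x))"
        by (rule continuous_on_compose2[OF G_continuous])
          (auto intro: linear_continuous_on matrix_vector_mul_bounded_linear)
      show "bump (G (T *v x)) = 0" if "2 * \<rho> < norm x" for x
        using T_lower[of x] that by (intro \<rho>) simp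
    qed (rule G_nonneg)
    \<comment> \<open>Substitution \<open>y = M x\<close>, whose Jacobian is
      \<open>(\<beta> - 1) * w x\<close> by the Monge-Ampere equation.\<close>
    have push: "f absolutely_integrable_on ?S \<and> integral ?S f = (\<beta> - 1) * integral ?S g"
      if g: "g absolutely_integrable_on ?S" and fg: "\<And>x. x \<in> ?S \<Longrightarrow> f (M x) * w x = g x"
      for f g :: "real^'m::_ \<Rightarrow> real"
    proof -
      have eq: "\<bar>det (D x)\<bar> * f (M x) = (\<beta> - 1) * g x" if "x \<in> ?S" for x
        using absdet[OF that] fg[OF that] by (simp add: mult_ac)
      have "(\<lambda>x. (\<beta> - 1) * g x) absolutely_integrable_on ?S"
        using g by auto
      then have "(\<lambda>x. \<bar>det (D x)\<bar> * f (M x)) absolutely_integrable_on ?S"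
        by (subst set_integrable_cong[OF refl refl eq])
      from absolutely_integrable_change_of_variables_real[OF Sl Mder inj_M this]
      have "f absolutely_integrable_on ?S"
        "integral ?S f = integral ?S (\<lambda>x. \<bar>det (D x)\<bar> * f (M x))"
        by (simp_all add: surj_M)
      moreover have "integral ?S (\<lambda>x. \<bar>det (D x)\<bar> * f (M x)) = integral ?S (\<lambda>x. (\<beta> - 1) * g x)"
        by (intro integral_cong eq)
      ultimately show ?thesis by simp
    qed
    have linear: "(\<lambda>y. f (B *v y)) absolutely_integrable_on ?S \<and> integral ?S (\<lambda>y. f (B *v y)) = integral ?S f"
      if f: "f absolutely_integrable_on ?S" for f :: "real^'m::_ \<Rightarrow> real"
    proof -
      have Tim: "(*v) T ` ?S = ?S"
      proof (intro antisym subsetI)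
        fix x assume "x \<in> (*v) T ` ?S"
        then show "x \<in> ?S"
          using BTx(1) by (metis ComplI image_iff matrix_vector_mult_0_right singletonD ComplD singletonI)
      next
        fix x assume "x \<in> ?S"
        then show "x \<in> (*v) T ` ?S"
          using Bne[of x] BTx(2)[of x] by (intro image_eqI[of _ _ "B *v x"]) auto
      qed
      have Tinj: "inj_on ((*v) T) ?S"
        by (metis BTx(1) inj_on_def)
      have Tder: "((*v) T has_derivative (*v) T) (at x within ?S)" for x
        by (intro bounded_linear_imp_has_derivative) (simp add: matrix_vector_mul_bounded_linear)
      have "det B * det T = 1"
        by (metis BT(1) det_I det_mul)
      then have detT: "det T = 1" using detB by simp
      have "(\<lambda>x. \<bar>det T\<bar> * f (B *v (T *v x))) absolutely_integrable_on ?S"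
        using f by (simp add: detT)
      from absolutely_integrable_change_of_variables_real[OF Sl Tder Tinj this]
      show ?thesis by (simp add: Tim detT)
    qed
    let ?I0 = "integral ?S (\<lambda>x. bump (G x) * w x)" and ?I1 = "integral ?S (\<lambda>x. bump (G (T *v x)) * w x)"
    have i1: "(\<lambda>y. bump (G (T *v M_inv y))) absolutely_integrable_on ?S \<and>
        integral ?S (\<lambda>y. bump (G (T *v M_inv y))) = (\<beta> - 1) * ?I1"
      by (rule push[OF intT]) (simp add: M_inv)
    have i0: "(\<lambda>y. bump (G (M_inv y))) absolutely_integrable_on ?S \<and>
        integral ?S (\<lambda>y. bump (G (M_inv y))) = (\<beta> - 1) * ?I0"
      by (rule push[OF int0]) (simp add: M_inv)
    have i2: "(\<lambda>y. bump (G (M_inv (B *v y)))) absolutely_integrable_on ?S \<and>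
        integral ?S (\<lambda>y. bump (G (M_inv (B *v y)))) = (\<beta> - 1) * ?I0"
      using linear[OF conjunct1[OF i0]] i0 by simp
    define c where "c = 2 * (X * R)\<^sup>2 * t\<^sup>2"
    have c: "0 \<le> c" by (simp add: c_def)
    have cint: "(\<lambda>y. if y \<in> cball 0 R then c else 0) integrable_on ?S"
      and cle: "integral ?S (\<lambda>y. if y \<in> cball 0 R then c else 0) \<le> K * t\<^sup>2"
    proof -
      have m: "?S \<inter> cball 0 R \<in> lmeasurable"
        by (intro bounded_set_imp_lmeasurable) (auto simp: bounded_Int)
      then have i: "(\<lambda>y. c) integrable_on (?S \<inter> cball 0 R)"
        by (simp add: integrable_on_const)
      then show "(\<lambda>y. if y \<in> cball 0 R then c else 0) integrable_on ?S"
        by (subst integrable_restrict_Int) (simp add: Int_commute)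
      have "integral ?S (\<lambda>y. if y \<in> cball 0 R then c else 0) = integral (?S \<inter> cball 0 R) (\<lambda>y. c * 1)"
        by (subst integral_restrict_Int) (simp add: Int_commute)
      also have "\<dots> \<le> integral (cball (0::real^'m::_) R) (\<lambda>y. c * 1)"
        using i c by (intro integral_subset_le) (auto simp: integrable_on_const)
      also have "\<dots> = c * measure lborel (cball (0::real^'m::_) R)"
        by (simp only: integral_mult_right lmeasure_integral[OF lmeasurable_cball, symmetric])
          (simp add: measure_completion)
      finally show "integral ?S (\<lambda>y. if y \<in> cball 0 R then c else 0) \<le> K * t\<^sup>2"
        by (simp add: c_def K_def mult_ac)
    qed
    note ints = i0[THEN conjunct1, THEN set_lebesgue_integral_eq_integral(1)]
      i1[THEN conjunct1, THEN set_lebesgue_integral_eq_integral(1)]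
      i2[THEN conjunct1, THEN set_lebesgue_integral_eq_integral(1)]
    have "integral ?S (\<lambda>y. bump (G (T *v M_inv y)) + (\<beta> - 1) * bump (G (M_inv (B *v y))))
        \<le> integral ?S (\<lambda>y. \<beta> * bump (G (M_inv y)) + (if y \<in> cball 0 R then c else 0))"
      unfolding c_def
      by (intro integral_le integrable_add integrable_on_mult_right ints pointwise cint[unfolded c_def])
    then have "(\<beta> - 1) * ?I1 + (\<beta> - 1) * ((\<beta> - 1) * ?I0) \<le> \<beta> * ((\<beta> - 1) * ?I0) + K * t\<^sup>2"
      using i0 i1 i2 cle
      by (simp add: integral_add ints integrable_on_mult_right cint del: mem_cball mem_cball_0)
    then have *: "(\<beta> - 1) * (?I1 - ?I0) \<le> K * t\<^sup>2"
      by (simp add: algebra_simps)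
    have "0 \<le> K * t\<^sup>2" by (simp add: K_def)
    have "?I1 - ?I0 \<le> K * t\<^sup>2"
    proof (cases "?I1 - ?I0 \<le> 0")
      case False
      then have "1 * (?I1 - ?I0) \<le> (\<beta> - 1) * (?I1 - ?I0)"
        using beta by (intro mult_right_mono) auto
      then show ?thesis using * by simp
    qed (use \<open>0 \<le> K * t\<^sup>2\<close> in linarith)
    \<comment> \<open>Replacing \<open>x\<close> by \<open>B *v x\<close> moves the distortion from
      the cut-off to the density.\<close>
    moreover have intB: "(\<lambda>x. bump (G x) * w (B *v x)) absolutely_integrable_on ?S \<and>
        integral ?S (\<lambda>x. bump (G x) * w (B *v x)) = ?I1"
      using linear[OF intT] by simp
    ultimately show "(\<lambda>x. bump (G x) * (w (B *v x) - w x)) absolutely_integrable_on ?S \<and>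
      integral ?S (\<lambda>x. bump (G x) * (w (B *v x) - w x)) \<le> K * t\<^sup>2"
      using int0 by (simp add: right_diff_distrib integral_diff set_lebesgue_integral_eq_integral(1))
  qed
qed

end

section \<open>Contradiction from a first-order increase of the density\<close>

context monge_ampere_potential_continuous
begin

text \<open>A gain \<open>t * v\<close> would make the integral in
  \<open>second_order_estimate\<close> at least \<open>t\<close> times a constant, which cannot stay
  below a multiple of \<open>t\<^sup>2\<close> as \<open>t\<close> tends to 0. Positivity of
  \<open>v\<close> on a whole ray makes that constant positive, since the ray enters the support of
  the cut-off near the origin; the bound by \<open>w\<close> gives integrability.\<close>

lemma no_first_order_increase:
  fixes v :: "real^'m::_ \<Rightarrow> real"
  assumes v_cont: "continuous_on (- {0}) v" and v_nonneg: "\<And>x. x \<noteq> 0 \<Longrightarrow> 0 \<le> v x"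
    and v_pos: "\<And>s. 0 < s \<Longrightarrow> 0 < v (s *\<^sub>R a)" and a: "a \<noteq> 0"
    and v_le: "\<And>x. x \<noteq> 0 \<Longrightarrow> v x \<le> C * w x"
  shows "\<not> (\<forall>t. 0 < t \<longrightarrow> t \<le> 1 \<longrightarrow> (\<exists>B. det B = 1 \<and> transpose B = B \<and>
      (\<forall>y. norm (B *v y - y) \<le> L * t * norm y) \<and> (\<forall>x. x \<noteq> 0 \<longrightarrow> w x + t * v x \<le> w (B *v x))))"
proof
  assume *: "\<forall>t. 0 < t \<longrightarrow> t \<le> 1 \<longrightarrow> (\<exists>B. det B = 1 \<and> transpose B = B \<and>
      (\<forall>y. norm (B *v y - y) \<le> L * t * norm y) \<and> (\<forall>x. x \<noteq> 0 \<longrightarrow> w x + t * v x \<le> w (B *v x)))"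
  let ?S = "- {0} :: (real^'m::_) set"
  let ?J = "integral ?S (\<lambda>x. bump (G x) * v x)"
  obtain K where K: "\<And>t B. \<lbrakk>0 \<le> t; t \<le> 1 / 2; det B = 1; transpose B = B; \<And>y. norm (B *v y - y) \<le> t * norm y\<rbrakk> \<Longrightarrow>
      (\<lambda>x. bump (G x) * (w (B *v x) - w x)) absolutely_integrable_on ?S \<and>
      integral ?S (\<lambda>x. bump (G x) * (w (B *v x) - w x)) \<le> K * t\<^sup>2"
    using second_order_estimate by blast
  have bv_cont: "continuous_on ?S (\<lambda>x. bump (G x) * v x)"
    by (intro continuous_intros v_cont G_cont)
  have bv_int: "(\<lambda>x. bump (G x) * v x) absolutely_integrable_on ?S"
  proof -
    obtain \<rho> where \<rho>: "\<And>x. \<rho> < norm x \<Longrightarrow> bump (G x) = 0"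
      using bump_G_support by blast
    have "(\<lambda>x. bump (G x) * w x) absolutely_integrable_on ?S"
      by (rule bump_w_integrable[OF G_continuous, of \<rho>]) (auto simp: \<rho> G_nonneg)
    then have "(\<lambda>x. C * (bump (G x) * w x)) integrable_on ?S"
      by (intro integrable_on_mult_right set_lebesgue_integral_eq_integral(1))
    then show ?thesis
    proof (rule measurable_bounded_by_integrable_imp_absolutely_integrable[rotated 2])
      show "(\<lambda>x. bump (G x) * v x) \<in> borel_measurable (lebesgue_on ?S)"
        by (rule continuous_imp_measurable_on_sets_lebesgue[OF bv_cont]) simp
      show "norm (bump (G x) * v x) \<le> C * (bump (G x) * w x)" if "x \<in> ?S" for x
        using v_le[of x] v_nonneg[of x] that bump_nonneg[of "G x"] mult_left_mono[of "v x" "C * w x" "bump (G x)"]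
        by (simp add: mult_ac)
    qed simp
  qed
  have J: "0 < ?J"
  proof -
    \<comment> \<open>Chosen so that \<open>G (s *\<^sub>R a) \<le> s * G a < 1\<close>, which puts
      the point where the cut-off is positive.\<close>
    define s where "s = min 1 (1 / (2 * G a))"
    have Ga: "0 < G a" using G_pos a by simp
    then have s: "0 < s" "s \<le> 1" "s * G a < 1"
      by (auto simp: s_def min_def field_simps)
    have "s powr \<beta> \<le> s powr 1"
      using s beta by (intro powr_mono') auto
    then have "G (s *\<^sub>R a) \<le> s * G a"
      using s Ga by (simp add: G_hom)
    then have "0 < bump (G (s *\<^sub>R a))"
      using s by (simp add: bump_def)
    then have "0 < bump (G (s *\<^sub>R a)) * v (s *\<^sub>R a)"
      using v_pos s by simp
    with s a show ?thesis
      by (intro integral_pos_open[where a = "s *\<^sub>R a"] bv_cont bv_int)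
        (auto intro!: mult_nonneg_nonneg bump_nonneg v_nonneg)
  qed
  \<comment> \<open>With \<open>L' \<ge> 1\<close> the condition \<open>L' * t \<le> 1 / 2\<close>
    also ensures \<open>t \<le> 1\<close>.\<close>
  define L' where "L' = max 1 \<bar>L\<bar>"
  have L': "1 \<le> L'" "L \<le> L'" by (auto simp: L'_def)
  have small: "?J \<le> K * L'\<^sup>2 * t" if t: "0 < t" "L' * t \<le> 1 / 2" for t
  proof -
    have "1 * t \<le> L' * t" using t L' by (intro mult_right_mono) auto
    then have "t \<le> 1" using t by linarith
    with * t obtain B where B: "det B = 1" "transpose B = B" "\<And>y. norm (B *v y - y) \<le> L * t * norm y"
      "\<And>x. x \<noteq> 0 \<Longrightarrow> w x + t * v x \<le> w (B *v x)"
      by blast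
    have near: "norm (B *v y - y) \<le> L' * t * norm y" for y
      using B(3)[of y] L' t by (meson mult_right_mono less_imp_le norm_ge_zero order_trans)
    have est: "(\<lambda>x. bump (G x) * (w (B *v x) - w x)) absolutely_integrable_on ?S"
      "integral ?S (\<lambda>x. bump (G x) * (w (B *v x) - w x)) \<le> K * (L' * t)\<^sup>2"
      using K[of "L' * t" B, OF _ t(2) B(1,2) near] t L' by auto
    have "t * ?J = integral ?S (\<lambda>x. t * (bump (G x) * v x))"
      by simp
    also have "\<dots> \<le> integral ?S (\<lambda>x. bump (G x) * (w (B *v x) - w x))"
    proof (rule integral_le)
      show "(\<lambda>x. t * (bump (G x) * v x)) integrable_on ?S"
        by (intro integrable_on_mult_right set_lebesgue_integral_eq_integral(1) bv_int)
      show "t * (bump (G x) * v x) \<le> bump (G x) * (w (B *v x) - w x)" if "x \<in> ?S" for x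
        using B(4)[of x] that mult_left_mono[of "t * v x" "w (B *v x) - w x" "bump (G x)"] bump_nonneg[of "G x"]
        by (simp add: mult_ac)
    qed (use est set_lebesgue_integral_eq_integral(1) in blast)
    also have "\<dots> \<le> t * (K * L'\<^sup>2 * t)"
      using est(2) by (simp add: power2_eq_square mult_ac)
    finally show ?thesis using t by simp
  qed
  define c where "c = \<bar>K * L'\<^sup>2\<bar> + 1"
  \<comment> \<open>At this \<open>t\<close> the quadratic side is at most half of the positive
    integral.\<close>
  define t where "t = min (1 / (2 * L')) (?J / (2 * c))"
  have "c > 0" by (simp add: c_def)
  have t: "0 < t" "L' * t \<le> 1 / 2" "c * t \<le> ?J / 2"
    using J L' \<open>c > 0\<close> by (auto simp: t_def min_def field_simps)
  have "?J \<le> K * L'\<^sup>2 * t" using small t by blast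
  also have "\<dots> \<le> c * t"
    using t by (intro mult_right_mono) (auto simp: c_def)
  finally show False using t(3) J by simp
qed

end

section \<open>The potential of a solution\<close>

locale support_function =
  fixes h :: "real^'m \<Rightarrow> real" and g :: "real^'m \<Rightarrow> real^'m" and H :: "real^'m \<Rightarrow> real^'m^'m" and \<beta> :: real
  assumes k_der: "x \<noteq> 0 \<Longrightarrow> (hom0 h has_derivative (\<lambda>v. g x \<bullet> v)) (at x)"
    and g_der: "x \<noteq> 0 \<Longrightarrow> (g has_derivative (\<lambda>v. H x *v v)) (at x)"
    and pos: "norm x = 1 \<Longrightarrow> 0 < h x"
    and psd: "norm x = 1 \<Longrightarrow> v \<bullet> x = 0 \<Longrightarrow> 0 \<le> v \<bullet> (H x *v v) + h x * (v \<bullet> v)"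
    and beta: "2 \<le> \<beta>"
begin

text \<open>The 1-homogeneous extension of \<open>h\<close>: the support function of the convex body
  on the whole space.\<close>

definition supp :: "real^'m \<Rightarrow> real" where
  "supp x = norm x * hom0 h x"

definition supp_grad :: "real^'m \<Rightarrow> real^'m" where
  "supp_grad x = (hom0 h x / norm x) *\<^sub>R x + norm x *\<^sub>R g x"

text \<open>The product rule applied to \<open>supp_grad\<close>, kept as a map on vectors; a matrix
  is formed only for the potential.\<close>

definition supp_hess :: "real^'m \<Rightarrow> real^'m \<Rightarrow> real^'m" where
  "supp_hess x v = ((g x \<bullet> v) / norm x - hom0 h x * (x \<bullet> v) / norm x ^ 3) *\<^sub>R x
    + (hom0 h x / norm x) *\<^sub>R v + ((x \<bullet> v) / norm x) *\<^sub>R g x + norm x *\<^sub>R (H x *v v)"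

section \<open>Homogeneity and derivatives of the support function\<close>

lemma hom0_scale: assumes "0 < s" shows "hom0 h (s *\<^sub>R x) = hom0 h x"
proof -
  have "inverse s * inverse (norm x) * s = inverse (norm x)"
    using assms by (simp add: field_simps)
  moreover have "(s *\<^sub>R x) /\<^sub>R norm (s *\<^sub>R x) = (inverse s * inverse (norm x) * s) *\<^sub>R x"
    using assms by simp
  ultimately show ?thesis
    by (simp only: hom0_def)
qed

lemma hom0_unit: "norm x = 1 \<Longrightarrow> hom0 h x = h x"
  by (simp add: hom0_def)

lemma scale_derivative: "((\<lambda>x. s *\<^sub>R x) has_derivative (\<lambda>v. s *\<^sub>R v)) (at x)" for x :: "real^'m"
  by (auto intro!: derivative_eq_intros)

lemma ray_derivative: "((\<lambda>s. s *\<^sub>R x) has_derivative (\<lambda>t. t *\<^sub>R x)) (at s)" for x :: "real^'m" and s :: real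
  by (auto intro!: derivative_eq_intros)

lemma g_radial: assumes "x \<noteq> 0" shows "g x \<bullet> x = 0"
proof -
  have "(hom0 h has_derivative (\<lambda>v. g x \<bullet> v)) (at (1 *\<^sub>R x))"
    using k_der[OF assms] by simp
  then have "((\<lambda>s. hom0 h (s *\<^sub>R x)) has_derivative (\<lambda>t. g x \<bullet> (t *\<^sub>R x))) (at 1)"
    by (rule has_derivative_compose[OF ray_derivative])
  then have "((\<lambda>s. hom0 h x) has_derivative (\<lambda>t. g x \<bullet> (t *\<^sub>R x))) (at (1::real))"
    by (rule has_derivative_transform_within_open[of _ _ _ _ "{0<..}"]) (auto simp: hom0_scale)
  then have "(\<lambda>t::real. g x \<bullet> (t *\<^sub>R x)) = (\<lambda>t. 0)"
    by (rule has_derivative_unique) simp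
  from fun_cong[OF this, of 1] show ?thesis by simp
qed

text \<open>The gradient of a 0-homogeneous function is homogeneous of degree -1: the derivative of
  \<open>hom0 h (s *\<^sub>R x)\<close> in \<open>x\<close> is computed in two ways.\<close>

lemma g_scale: assumes "x \<noteq> 0" "0 < s" shows "s *\<^sub>R g (s *\<^sub>R x) = g x"
proof -
  have "((\<lambda>x. hom0 h (s *\<^sub>R x)) has_derivative (\<lambda>v. g (s *\<^sub>R x) \<bullet> (s *\<^sub>R v))) (at x)"
    using assms by (intro has_derivative_compose[OF scale_derivative] k_der) auto
  then have "(hom0 h has_derivative (\<lambda>v. g (s *\<^sub>R x) \<bullet> (s *\<^sub>R v))) (at x)"
    using assms by (simp add: hom0_scale)
  then have "(\<lambda>v. g (s *\<^sub>R x) \<bullet> (s *\<^sub>R v)) = (\<lambda>v. g x \<bullet> v)"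
    using k_der[OF assms(1)] by (rule has_derivative_unique)
  then have "(s *\<^sub>R g (s *\<^sub>R x) - g x) \<bullet> v = 0" for v
    by (simp add: fun_eq_iff inner_diff_left)
  from this[of "s *\<^sub>R g (s *\<^sub>R x) - g x"] show ?thesis by simp
qed

lemma supp_scale: "0 < s \<Longrightarrow> supp (s *\<^sub>R x) = s * supp x"
  by (simp add: supp_def hom0_scale)

lemma supp_grad_scale: "x \<noteq> 0 \<Longrightarrow> 0 < s \<Longrightarrow> supp_grad (s *\<^sub>R x) = supp_grad x"
  by (simp add: supp_grad_def hom0_scale flip: g_scale[of x s])

lemma supp_grad_radial: "x \<noteq> 0 \<Longrightarrow> supp_grad x \<bullet> x = supp x"
  by (simp add: supp_grad_def supp_def g_radial inner_add_left dot_square_norm power2_eq_square)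

lemma norm_deriv: "x \<noteq> 0 \<Longrightarrow> (norm has_derivative (\<lambda>v. (x \<bullet> v) / norm x)) (at x)" for x :: "real^'m"
  using has_derivative_norm[of x] by (simp add: sgn_div_norm inner_commute divide_inverse mult.commute)

lemma supp_der: assumes "x \<noteq> 0" shows "(supp has_derivative (\<lambda>v. supp_grad x \<bullet> v)) (at x)"
proof -
  have "(supp has_derivative (\<lambda>v. norm x * (g x \<bullet> v) + (x \<bullet> v) / norm x * hom0 h x)) (at x)"
    unfolding supp_def[abs_def] by (rule has_derivative_mult[OF norm_deriv k_der]) fact+
  also have "(\<lambda>v. norm x * (g x \<bullet> v) + (x \<bullet> v) / norm x * hom0 h x) = (\<lambda>v. supp_grad x \<bullet> v)"
    by (simp add: fun_eq_iff supp_grad_def inner_add_left)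
  finally show ?thesis .
qed

lemma supp_grad_der: assumes "x \<noteq> 0" shows "(supp_grad has_derivative supp_hess x) (at x)"
proof -
  have "((\<lambda>x. hom0 h x / norm x) has_derivative
      (\<lambda>v. - hom0 h x * (inverse (norm x) * ((x \<bullet> v) / norm x) * inverse (norm x)) + (g x \<bullet> v) / norm x)) (at x)"
    using assms by (intro has_derivative_divide k_der norm_deriv) auto
  then have "(supp_grad has_derivative
     (\<lambda>v. ((hom0 h x / norm x) *\<^sub>R v + (- hom0 h x * (inverse (norm x) * ((x \<bullet> v) / norm x) * inverse (norm x)) + (g x \<bullet> v) / norm x) *\<^sub>R x)
       + (norm x *\<^sub>R (H x *v v) + ((x \<bullet> v) / norm x) *\<^sub>R g x))) (at x)"
    unfolding supp_grad_def[abs_def]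
    by (intro has_derivative_add has_derivative_scaleR has_derivative_ident g_der norm_deriv assms)
  also have "(\<lambda>v. ((hom0 h x / norm x) *\<^sub>R v + (- hom0 h x * (inverse (norm x) * ((x \<bullet> v) / norm x) * inverse (norm x)) + (g x \<bullet> v) / norm x) *\<^sub>R x)
       + (norm x *\<^sub>R (H x *v v) + ((x \<bullet> v) / norm x) *\<^sub>R g x)) = supp_hess x"
    using assms by (simp add: fun_eq_iff supp_hess_def field_simps power3_eq_cube)
  finally show ?thesis .
qed

lemma supp_hess_linear: "x \<noteq> 0 \<Longrightarrow> linear (supp_hess x)"
  using supp_grad_der has_derivative_linear by blast

lemma supp_hess_scale: assumes "x \<noteq> 0" "0 < s" shows "s *\<^sub>R supp_hess (s *\<^sub>R x) v = supp_hess x v"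
proof -
  have sx: "s *\<^sub>R x \<noteq> 0" using assms by auto
  have "((\<lambda>x. supp_grad (s *\<^sub>R x)) has_derivative (\<lambda>v. supp_hess (s *\<^sub>R x) (s *\<^sub>R v))) (at x)"
    by (intro has_derivative_compose[OF scale_derivative] supp_grad_der sx)
  then have "(supp_grad has_derivative (\<lambda>v. supp_hess (s *\<^sub>R x) (s *\<^sub>R v))) (at x)"
    by (rule has_derivative_transform_within_open[of _ _ _ _ "- {0}"])
      (use assms in \<open>auto simp: supp_grad_scale\<close>)
  then have "(\<lambda>v. supp_hess (s *\<^sub>R x) (s *\<^sub>R v)) = supp_hess x"
    using supp_grad_der[OF assms(1)] by (rule has_derivative_unique)
  then show ?thesis
    using linear_cmul[OF supp_hess_linear[OF sx]] by (metis (mono_tags))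
qed

lemma supp_hess_radial_right: assumes "x \<noteq> 0" shows "supp_hess x x = 0"
proof -
  have "(supp_grad has_derivative supp_hess x) (at (1 *\<^sub>R x))"
    using supp_grad_der[OF assms] by simp
  then have "((\<lambda>s. supp_grad (s *\<^sub>R x)) has_derivative (\<lambda>t. supp_hess x (t *\<^sub>R x))) (at 1)"
    by (rule has_derivative_compose[OF ray_derivative])
  then have "((\<lambda>s. supp_grad x) has_derivative (\<lambda>t. supp_hess x (t *\<^sub>R x))) (at (1::real))"
    by (rule has_derivative_transform_within_open[of _ _ _ _ "{0<..}"])
      (use assms in \<open>auto simp: supp_grad_scale\<close>)
  then have "(\<lambda>t::real. supp_hess x (t *\<^sub>R x)) = (\<lambda>t. 0)"
    by (rule has_derivative_unique) simp
  from fun_cong[OF this, of 1] show ?thesis by simp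
qed

text \<open>Differentiating Euler's identity \<open>supp_grad x \<bullet> x = supp x\<close> cancels
  the gradient terms. With \<open>supp_hess_radial_right\<close>, the radial row and column of the
  Hessian vanish.\<close>

lemma supp_hess_radial_left: assumes "x \<noteq> 0" shows "x \<bullet> supp_hess x v = 0"
proof -
  have "((\<lambda>x. supp_grad x \<bullet> x) has_derivative (\<lambda>v. supp_grad x \<bullet> v + supp_hess x v \<bullet> x)) (at x)"
    by (intro has_derivative_inner supp_grad_der assms has_derivative_ident)
  then have "(supp has_derivative (\<lambda>v. supp_grad x \<bullet> v + supp_hess x v \<bullet> x)) (at x)"
    by (rule has_derivative_transform_within_open[of _ _ _ _ "- {0}"])
      (use assms in \<open>auto simp: supp_grad_radial\<close>)
  from has_derivative_unique[OF this supp_der[OF assms]] show ?thesis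
    by (auto simp: fun_eq_iff inner_commute)
qed

text \<open>On tangent vectors of the sphere the Euclidean Hessian of the support function is the
  covariant matrix of the equation.\<close>

lemma supp_hess_tangential:
  assumes "norm x = 1" "x \<bullet> u = 0" "x \<bullet> v = 0"
  shows "u \<bullet> supp_hess x v = h x * (u \<bullet> v) + u \<bullet> (H x *v v)"
  using assms by (simp add: supp_hess_def inner_add_right inner_commute[of u x] hom0_unit)

lemma supp_hess_psd:
  assumes x: "x \<noteq> 0"
  shows "0 \<le> v \<bullet> supp_hess x v"
proof -
  define u where "u = x /\<^sub>R norm x"
  define z where "z = v - (u \<bullet> v) *\<^sub>R u"
  have u: "norm u = 1" "u \<noteq> 0" using x by (auto simp: u_def)
  then have uu: "u \<bullet> u = 1" by (simp add: dot_square_norm)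
  have v: "v = (u \<bullet> v) *\<^sub>R u + z" by (simp add: z_def)
  have uz: "u \<bullet> z = 0" by (simp add: z_def inner_diff_right uu)
  have "supp_hess u v = supp_hess u z"
    by (subst v) (simp add: linear_add[OF supp_hess_linear] linear_cmul[OF supp_hess_linear] u supp_hess_radial_right)
  then have "v \<bullet> supp_hess u v = z \<bullet> supp_hess u z"
    by (subst v) (simp add: inner_add_left supp_hess_radial_left u)
  also have "\<dots> = h u * (z \<bullet> z) + z \<bullet> (H u *v z)"
    by (rule supp_hess_tangential) (use u uz in auto)
  also have "\<dots> \<ge> 0"
    using psd[of u z] u uz by (simp add: inner_commute add.commute)
  finally have "0 \<le> v \<bullet> supp_hess u v" .
  moreover have "supp_hess u v = norm x *\<^sub>R supp_hess x v"
    using supp_hess_scale[of u "norm x" v] x u by (simp add: u_def)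
  ultimately show ?thesis
    using x by (simp add: zero_le_mult_iff)
qed

section \<open>The power potential and its Hessian determinant\<close>

definition pot :: "real^'m \<Rightarrow> real" where
  "pot x = supp x powr \<beta> / \<beta>"

definition pot_grad :: "real^'m \<Rightarrow> real^'m" where
  "pot_grad x = supp x powr (\<beta> - 1) *\<^sub>R supp_grad x"

definition pot_hess :: "real^'m \<Rightarrow> real^'m^'m" where
  "pot_hess x = matrix (\<lambda>v. supp x powr (\<beta> - 1) *\<^sub>R supp_hess x v
     + ((\<beta> - 1) * supp x powr (\<beta> - 2) * (supp_grad x \<bullet> v)) *\<^sub>R supp_grad x)"

lemma supp_pos: "x \<noteq> 0 \<Longrightarrow> 0 < supp x"
  by (simp add: supp_def hom0_def pos)

lemma pot_hess_mult: assumes "x \<noteq> 0" shows "pot_hess x *v v = supp x powr (\<beta> - 1) *\<^sub>R supp_hess x v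
     + ((\<beta> - 1) * supp x powr (\<beta> - 2) * (supp_grad x \<bullet> v)) *\<^sub>R supp_grad x"
proof -
  have l: "linear (\<lambda>v. supp x powr (\<beta> - 1) *\<^sub>R supp_hess x v
     + ((\<beta> - 1) * supp x powr (\<beta> - 2) * (supp_grad x \<bullet> v)) *\<^sub>R supp_grad x)"
    by (rule linearI)
      (simp_all add: linear_add[OF supp_hess_linear[OF assms]] linear_cmul[OF supp_hess_linear[OF assms]]
        inner_add_right algebra_simps)
  show ?thesis
    unfolding pot_hess_def by (rule fun_cong[OF matrix_vector_mul(2)[OF l]])
qed

lemma pot_der: assumes "x \<noteq> 0" shows "(pot has_derivative (\<lambda>v. pot_grad x \<bullet> v)) (at x)"
proof -
  have "((\<lambda>z. z powr \<beta> / \<beta>) has_real_derivative supp x powr (\<beta> - 1)) (at (supp x))"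
    using supp_pos[OF assms] beta by (auto intro!: derivative_eq_intros)
  from has_derivative_compose[OF supp_der[OF assms] this[unfolded has_field_derivative_def]]
  show ?thesis
    by (simp add: pot_def[abs_def] pot_grad_def)
qed

lemma pot_grad_der: assumes "x \<noteq> 0" shows "(pot_grad has_derivative (\<lambda>v. pot_hess x *v v)) (at x)"
proof -
  have "((\<lambda>z. z powr (\<beta> - 1)) has_real_derivative (\<beta> - 1) * supp x powr (\<beta> - 2)) (at (supp x))"
    using supp_pos[OF assms] by (auto intro!: derivative_eq_intros)
  from has_derivative_compose[OF supp_der[OF assms] this[unfolded has_field_derivative_def]]
  have "((\<lambda>x. supp x powr (\<beta> - 1)) has_derivative (\<lambda>v. (\<beta> - 1) * supp x powr (\<beta> - 2) * (supp_grad x \<bullet> v))) (at x)" .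
  from has_derivative_scaleR[OF this supp_grad_der[OF assms]] show ?thesis
    by (simp add: pot_grad_def[abs_def] pot_hess_mult[OF assms])
qed

lemma pot_grad_scale: "0 < s \<Longrightarrow> pot_grad (s *\<^sub>R x) = s powr (\<beta> - 1) *\<^sub>R pot_grad x"
  using beta supp_pos[of x]
  by (cases "x = 0") (simp_all add: pot_grad_def supp_scale supp_grad_scale powr_mult, simp add: supp_def)

lemma pot_hess_psd: assumes "x \<noteq> 0" shows "0 \<le> v \<bullet> (pot_hess x *v v)"
proof -
  have "v \<bullet> (pot_hess x *v v) = supp x powr (\<beta> - 1) * (v \<bullet> supp_hess x v)
      + (\<beta> - 1) * supp x powr (\<beta> - 2) * (supp_grad x \<bullet> v)\<^sup>2"
    by (simp add: pot_hess_mult[OF assms] inner_add_right inner_commute[of v "supp_grad x"] power2_eq_square mult.assoc)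
  also have "\<dots> \<ge> 0"
    using beta supp_hess_psd[OF assms] by simp
  finally show ?thesis .
qed

lemma pot_hess_scale: assumes "x \<noteq> 0" "0 < s" shows "pot_hess (s *\<^sub>R x) = s powr (\<beta> - 2) *\<^sub>R pot_hess x"
proof -
  have sx: "s *\<^sub>R x \<noteq> 0" using assms by auto
  have "((\<lambda>x. pot_grad (s *\<^sub>R x)) has_derivative (\<lambda>v. pot_hess (s *\<^sub>R x) *v (s *\<^sub>R v))) (at x)"
    by (intro has_derivative_compose[OF scale_derivative] pot_grad_der sx)
  then have 1: "((\<lambda>x. s powr (\<beta> - 1) *\<^sub>R pot_grad x) has_derivative (\<lambda>v. pot_hess (s *\<^sub>R x) *v (s *\<^sub>R v))) (at x)"
    by (simp add: pot_grad_scale assms)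
  have "((\<lambda>x. s powr (\<beta> - 1) *\<^sub>R pot_grad x) has_derivative (\<lambda>v. s powr (\<beta> - 1) *\<^sub>R (pot_hess x *v v))) (at x)"
    by (intro has_derivative_scaleR_right pot_grad_der assms)
  from has_derivative_unique[OF 1 this]
  have "s *\<^sub>R (pot_hess (s *\<^sub>R x) *v v) = s *\<^sub>R (s powr (\<beta> - 2) *\<^sub>R (pot_hess x *v v))" for v
    using assms by (simp add: fun_eq_iff matrix_vector_mult_scaleR powr_diff) (simp add: power2_eq_square powr_numeral)
  then have "pot_hess (s *\<^sub>R x) *v v = s powr (\<beta> - 2) *\<^sub>R (pot_hess x *v v)" for v
    using assms(2) by (metis less_irrefl scaleR_left_imp_eq)
  then have "pot_hess (s *\<^sub>R x) *v v = (s powr (\<beta> - 2) *\<^sub>R pot_hess x) *v v" for v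
    by (simp only: scaleR_matrix_vector_assoc)
  then show ?thesis
    by (simp add: matrix_eq)
qed

text \<open>In an orthonormal basis made of \<open>x\<close> and a tangential frame, the radial
  entry is the pivot \<open>(\<beta> - 1) * h x powr \<beta>\<close>. The Schur complement removes
  the rank-one gradient term and leaves \<open>h x powr (\<beta> - 1)\<close> times the matrix of
  the equation.\<close>

lemma det_pot_hess_unit:
  assumes card: "CARD('m) = CARD('n::finite) + 1" and x: "norm x = 1"
    and frame: "\<And>e :: 'n \<Rightarrow> real^'m. sphere_frame x e \<Longrightarrow>
      det (\<chi> i j. e i \<bullet> (H x *v e j) + (if i = j then h x else 0)) = d"
  shows "det (pot_hess x) = (\<beta> - 1) * h x powr (\<beta> + (\<beta> - 1) * CARD('n)) * d"
proof -
  \<comment> \<open>Any index can serve as the radial one: \<open>R\<close> is orthogonal with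
    \<open>x\<close> as its column \<open>k\<close>, so the other columns form a tangential
    frame.\<close>
  define k :: 'm where "k = undefined"
  obtain R where R: "orthogonal_matrix R" and Rk: "R *v axis k 1 = x"
    using orthogonal_matrix_exists_basis[OF x] by metis
  have "card (UNIV :: 'n set) = card (- {k})"
    using card by (simp add: Compl_eq_Diff_UNIV)
  then obtain b :: "'n \<Rightarrow> 'm" where b: "bij_betw b UNIV (- {k})"
    using finite_same_card_bij[of "UNIV :: 'n set" "- {k}"] by auto
  have inj: "b i = b j \<longleftrightarrow> i = j" and ne: "b i \<noteq> k" for i j
    using b by (auto simp: bij_betw_def inj_def)
  define E where "E i = R *v axis i 1" for i
  have E: "E i \<bullet> E j = (if i = j then 1 else 0)" for i j
  proof -
    have "orthogonal_transformation ((*v) R)"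
      using R by (simp add: orthogonal_transformation_matrix matrix_vector_mul_linear)
    then have "E i \<bullet> E j = axis i 1 \<bullet> (axis j 1 :: real^'m)"
      by (simp add: orthogonal_transformation_def E_def)
    then show ?thesis by (simp add: inner_axis_axis)
  qed
  have Ek: "E k = x" by (simp add: E_def Rk)
  have frame_b: "sphere_frame x (\<lambda>i. E (b i))"
    using E by (auto simp: sphere_frame_def inj ne simp flip: Ek)
  let ?P = "pot_hess x"
  define A where "A = transpose R ** ?P ** R"
  have A: "A $ i $ j = E i \<bullet> (?P *v E j)" for i j
  proof -
    have "A $ i $ j = axis i 1 \<bullet> (A *v axis j 1)"
      by (simp add: inner_axis' matrix_vector_mul_component column_def matrix_vector_mult_basis)
    also have "\<dots> = axis i 1 \<bullet> (transpose R *v (?P *v E j))"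
      by (simp add: A_def E_def matrix_vector_mul_assoc matrix_mul_assoc)
    also have "\<dots> = E i \<bullet> (?P *v E j)"
      by (metis E_def dot_lmul_matrix inner_commute transpose_matrix_vector)
    finally show ?thesis .
  qed
  have "det R * det R = 1"
    using R by (metis det_I det_mul det_transpose orthogonal_matrix)
  then have detA: "det ?P = det A"
    by (simp add: A_def det_mul)
  have x0: "x \<noteq> 0" using x by auto
  have hx: "0 < h x" and sx: "supp x = h x"
    using pos x by (auto simp: supp_def hom0_unit)
  have px: "supp_grad x \<bullet> x = h x"
    using supp_grad_radial[OF x0] sx by simp
  define q where "q i = supp_grad x \<bullet> E i" for i
  have qk: "q k = h x" by (simp add: q_def Ek px)
  have Aij: "A $ i $ j = h x powr (\<beta> - 1) * (E i \<bullet> supp_hess x (E j)) + (\<beta> - 1) * h x powr (\<beta> - 2) * q i * q j" for i j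
    by (simp add: A pot_hess_mult[OF x0] inner_add_right sx q_def inner_commute mult_ac)
  have Akj: "A $ k $ j = (\<beta> - 1) * h x powr (\<beta> - 2) * h x * q j" for j
    by (simp add: Aij qk Ek supp_hess_radial_left[OF x0])
  have Aik: "A $ i $ k = (\<beta> - 1) * h x powr (\<beta> - 2) * h x * q i" for i
    by (simp add: Aij qk Ek supp_hess_radial_right[OF x0])
  have hh: "h x powr (\<beta> - 2) * h x * h x = h x powr \<beta>"
    using hx by (simp add: powr_diff powr_numeral power2_eq_square)
  have Akk: "A $ k $ k = (\<beta> - 1) * h x powr \<beta>"
    by (simp add: Akj qk mult.assoc flip: hh)
  have nz: "A $ k $ k \<noteq> 0"
    using hx beta by (simp add: Akk)
  have entry: "A $ b i $ b j - A $ b i $ k * A $ k $ b j / A $ k $ k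
      = h x powr (\<beta> - 1) * (E (b i) \<bullet> (H x *v E (b j)) + (if i = j then h x else 0))" for i j
  proof -
    have "A $ b i $ k * A $ k $ b j / A $ k $ k = (\<beta> - 1) * h x powr (\<beta> - 2) * q (b i) * q (b j)"
    proof -
      have cancel: "(a * y * u) * (a * y * v) / (a * y * y) = a * u * v" if "a \<noteq> 0" "y \<noteq> 0" for a y u v :: real
        using that by (simp add: field_simps)
      have "(\<beta> - 1) * h x powr (\<beta> - 2) \<noteq> 0" "h x \<noteq> 0"
        using hx beta by auto
      from cancel[OF this, of "q (b i)" "q (b j)"] show ?thesis
        by (simp only: Akj Aik qk)
    qed
    then have "A $ b i $ b j - A $ b i $ k * A $ k $ b j / A $ k $ k = h x powr (\<beta> - 1) * (E (b i) \<bullet> supp_hess x (E (b j)))"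
      by (simp add: Aij)
    also have "E (b i) \<bullet> supp_hess x (E (b j)) = h x * (E (b i) \<bullet> E (b j)) + E (b i) \<bullet> (H x *v E (b j))"
      by (rule supp_hess_tangential) (use x E ne in \<open>auto simp flip: Ek\<close>)
    finally show ?thesis by (simp add: E inj)
  qed
  have "det A = A $ k $ k * det (\<chi> i j. A $ b i $ b j - A $ b i $ k * A $ k $ b j / A $ k $ k)"
    by (rule det_schur_single[OF b nz])
  also have "(\<chi> i j. A $ b i $ b j - A $ b i $ k * A $ k $ b j / A $ k $ k)
     = h x powr (\<beta> - 1) *\<^sub>R (\<chi> i j. E (b i) \<bullet> (H x *v E (b j)) + (if i = j then h x else 0))"
    by (simp add: vec_eq_iff entry)
  also have "det \<dots> = (h x powr (\<beta> - 1)) ^ CARD('n) * d"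
    by (simp add: det_scaleR_matrix frame[OF frame_b])
  also have "(h x powr (\<beta> - 1)) ^ CARD('n) = h x powr ((\<beta> - 1) * CARD('n))"
    using hx by (simp add: powr_powr flip: powr_realpow)
  finally show ?thesis
    by (simp add: detA Akk powr_add mult_ac)
qed

end

text \<open>The exponent \<open>\<beta>\<close> is the one for which all powers of \<open>h\<close> cancel in the determinant.\<close>

lemma monge_ampere_potential_of_solution:
  fixes e :: "real^'m"
  assumes sol: "Lp_Minkowski_solution TYPE('n::finite) p f h"
    and card: "CARD('m) = CARD('n) + 1"
    and q: "q = - real CARD('m) - p" "0 \<le> q"
    and f_nonneg: "\<And>x. norm x = 1 \<Longrightarrow> 0 \<le> f x"
    and f_pos: "\<And>x. norm x = 1 \<Longrightarrow> x \<notin> span {e} \<Longrightarrow> 0 < f x"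
  obtains G M D where
    "monge_ampere_potential G M D (2 + q / CARD('m)) (\<lambda>x. norm x powr q * f (x /\<^sub>R norm x)) e"
proof -
  obtain H where H: "C2_sphere_hess h H"
    and sol': "\<forall>x\<in>sphere 0 1. h x > 0 \<and>
      (\<forall>v. v \<bullet> x = 0 \<longrightarrow> v \<bullet> (H x *v v) + h x * (v \<bullet> v) \<ge> 0) \<and>
      (\<forall>e :: 'n \<Rightarrow> real^'m. sphere_frame x e \<longrightarrow>
        det (\<chi> i j. e i \<bullet> (H x *v e j) + (if i = j then h x else 0)) = f x * h x powr (p - 1))"
    using sol unfolding Lp_Minkowski_solution_def by blast
  obtain g where der: "\<And>x. x \<noteq> 0 \<Longrightarrow> (hom0 h has_derivative (\<lambda>v. g x \<bullet> v)) (at x)"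
      "\<And>x. x \<noteq> 0 \<Longrightarrow> (g has_derivative (\<lambda>v. H x *v v)) (at x)"
    using H unfolding C2_sphere_hess_def by blast
  have pos: "0 < h x" if "norm x = 1" for x
    using bspec[OF sol', of x] that by simp
  have psd: "0 \<le> v \<bullet> (H x *v v) + h x * (v \<bullet> v)" if "norm x = 1" "v \<bullet> x = 0" for x v
    using bspec[OF sol', of x] that by simp
  have eq: "det (\<chi> i j. e i \<bullet> (H x *v e j) + (if i = j then h x else 0)) = f x * h x powr (p - 1)"
    if "norm x = 1" "sphere_frame x e" for x and e :: "'n \<Rightarrow> real^'m"
    using bspec[OF sol', of x, THEN conjunct2, THEN conjunct2, rule_format, OF _ that(2)] that(1) by simp
  define \<beta> where "\<beta> = 2 + q / CARD('m)"
  have \<beta>: "2 \<le> \<beta>" using q by (simp add: \<beta>_def)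
  have \<beta>N: "(\<beta> - 2) * CARD('m) = q" by (simp add: \<beta>_def)
  interpret S: support_function h g H \<beta>
    by unfold_locales (fact der pos psd \<beta>)+
  let ?D = "S.pot_hess"
  \<comment> \<open>By the choice of \<open>\<beta>\<close>,
    \<open>(\<beta> - 2) * CARD('m) = q = - CARD('m) - p\<close>, which is exactly what makes the
    total exponent of \<open>h\<close> vanish.\<close>
  have expo: "\<beta> + (\<beta> - 1) * CARD('n) + (p - 1) = 0"
  proof -
    have cm: "real CARD('m) = real CARD('n) + 1"
      using card by simp
    have "\<beta> + (\<beta> - 1) * CARD('n) + (p - 1) = (\<beta> - 2) * (real CARD('n) + 1) + (real CARD('n) + 1) + p"
      by (simp add: algebra_simps)
    then show ?thesis
      using \<beta>N q(1) unfolding cm by linarith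
  qed
  have det_unit: "det (?D u) = (\<beta> - 1) * f u" if u: "norm u = 1" for u
  proof -
    have "h u powr (\<beta> + (\<beta> - 1) * CARD('n)) * h u powr (p - 1) = 1"
      using pos[OF u] by (simp only: powr_add[symmetric] expo) simp
    moreover have "det (?D u) = (\<beta> - 1) * h u powr (\<beta> + (\<beta> - 1) * CARD('n)) * (f u * h u powr (p - 1))"
      by (rule S.det_pot_hess_unit[OF card u]) (rule eq[OF u])
    moreover have "a * b * (c * d) = a * c * (b * d)" for a b c d :: real
      by simp
    ultimately show ?thesis by (metis mult.right_neutral)
  qed
  \<comment> \<open>The Hessian is homogeneous of degree \<open>\<beta> - 2\<close>, so its
    determinant has degree \<open>(\<beta> - 2) * CARD('m) = q\<close>.\<close>
  have det: "det (?D x) = (\<beta> - 1) * (norm x powr q * f (x /\<^sub>R norm x))" if x: "x \<noteq> 0" for x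
  proof -
    have "?D x = norm x powr (\<beta> - 2) *\<^sub>R ?D (x /\<^sub>R norm x)"
      using S.pot_hess_scale[of "x /\<^sub>R norm x" "norm x"] x by simp
    moreover have "(norm x powr (\<beta> - 2)) ^ CARD('m) = norm x powr q"
      using x by (simp add: powr_powr \<beta>N flip: powr_realpow)
    ultimately show ?thesis
      using x by (simp add: det_scaleR_matrix det_unit mult_ac)
  qed
  have "monge_ampere_potential S.pot S.pot_grad ?D \<beta> (\<lambda>x. norm x powr q * f (x /\<^sub>R norm x)) e"
  proof
    show "2 \<le> \<beta>" by (rule \<beta>)
    show "S.pot 0 = 0" "S.pot_grad 0 = 0"
      by (simp_all add: S.pot_def S.pot_grad_def S.supp_def)
    show "0 < S.pot x" if "x \<noteq> 0" for x
      using S.supp_pos[OF that] \<beta> by (simp add: S.pot_def)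
    show "S.pot (s *\<^sub>R x) = s powr \<beta> * S.pot x" if "0 < s" for s x
      using S.supp_pos[of x] S.supp_scale[OF that, of x] that
      by (cases "x = 0") (auto simp: S.pot_def powr_mult S.supp_def)
    show "0 < norm x powr q * f (x /\<^sub>R norm x)" if x: "x \<notin> span {e}" for x
    proof -
      have x0: "x \<noteq> 0" using x span_zero by blast
      have "x /\<^sub>R norm x \<notin> span {e}"
        using x x0 span_mul[of "x /\<^sub>R norm x" "{e}" "norm x"] by auto
      then show ?thesis
        using f_pos[of "x /\<^sub>R norm x"] x0 by simp
    qed
  qed (use det f_nonneg in \<open>auto simp: S.pot_grad_scale S.pot_der
      S.pot_grad_der S.pot_hess_psd\<close>)
  then show ?thesis using that by (simp add: \<beta>_def)
qed

section \<open>Volume-preserving squeezing along an axis\<close>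

text \<open>The symmetric matrix that, for a unit vector \<open>e\<close>, multiplies
  \<open>e\<close> by \<open>\<nu>\<close> and its orthogonal complement by
  \<open>\<mu>\<close>.\<close>

definition squeeze :: "real \<Rightarrow> real \<Rightarrow> real^'m \<Rightarrow> real^'m^'m" where
  "squeeze \<mu> \<nu> e = (\<chi> i j. (if i = j then \<mu> else 0) + (\<nu> - \<mu>) * e $ i * e $ j)"

lemma squeeze_mult: "squeeze \<mu> \<nu> e *v x = \<mu> *\<^sub>R x + ((\<nu> - \<mu>) * (e \<bullet> x)) *\<^sub>R e"
proof -
  have "(squeeze \<mu> \<nu> e *v x) $ i = \<mu> * x $ i + (\<nu> - \<mu>) * (e \<bullet> x) * e $ i" for i
  proof -
    have "(squeeze \<mu> \<nu> e *v x) $ i = (\<Sum>j\<in>UNIV. (if i = j then \<mu> * x $ j else 0) + (\<nu> - \<mu>) * e $ i * (e $ j * x $ j))"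
      by (simp add: squeeze_def matrix_vector_mult_def) (rule sum.cong, auto simp: algebra_simps)
    also have "\<dots> = \<mu> * x $ i + (\<nu> - \<mu>) * e $ i * (e \<bullet> x)"
      by (simp add: sum.distrib inner_vec_def flip: sum_distrib_left)
    finally show ?thesis by simp
  qed
  then show ?thesis by (simp add: vec_eq_iff)
qed

lemma transpose_squeeze: "transpose (squeeze \<mu> \<nu> e) = squeeze \<mu> \<nu> e"
  by (auto simp: squeeze_def transpose_def vec_eq_iff)

lemma det_squeeze:
  fixes e :: "real^'m"
  assumes "norm e = 1"
  shows "det (squeeze \<mu> \<nu> e) = \<mu> ^ (CARD('m) - 1) * \<nu>"
proof -
  define k :: 'm where "k = undefined"
  obtain R where R: "orthogonal_matrix R" and Rk: "R *v axis k 1 = e"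
    using orthogonal_matrix_exists_basis[OF assms] by metis
  define Dg :: "real^'m^'m" where "Dg = (\<chi> i j. if i = j then (if i = k then \<nu> else \<mu>) else 0)"
  have Dg: "Dg *v x = \<mu> *\<^sub>R x + ((\<nu> - \<mu>) * x $ k) *\<^sub>R axis k 1" for x
  proof -
    have "(Dg *v x) $ i = (if i = k then \<nu> else \<mu>) * x $ i" for i
    proof -
      have "(Dg *v x) $ i = (\<Sum>j\<in>UNIV. Dg $ i $ j * x $ j)"
        by (simp add: matrix_vector_mult_def)
      also have "\<dots> = (\<Sum>j\<in>UNIV. if j = i then (if i = k then \<nu> else \<mu>) * x $ i else 0)"
        by (rule sum.cong) (auto simp: Dg_def)
      finally show ?thesis by simp
    qed
    then show ?thesis
      by (simp add: vec_eq_iff axis_def algebra_simps)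
  qed
  have "orthogonal_transformation ((*v) R)"
    using R by (simp add: orthogonal_transformation_matrix matrix_vector_mul_linear)
  then have dot: "e \<bullet> (R *v x) = x $ k" for x
    by (simp add: orthogonal_transformation_def inner_axis' flip: Rk)
  have "squeeze \<mu> \<nu> e ** R = R ** Dg"
  proof (subst matrix_eq, rule allI)
    fix x
    show "(squeeze \<mu> \<nu> e ** R) *v x = (R ** Dg) *v x"
      by (simp add: squeeze_mult Dg dot matrix_vector_mul_assoc[symmetric] matrix_vector_right_distrib
          matrix_vector_mult_scaleR Rk)
  qed
  then have "det (squeeze \<mu> \<nu> e) * det R = det R * det Dg"
    by (metis det_mul)
  moreover have "det R \<noteq> 0"
    using R det_orthogonal_matrix by force
  moreover have "det Dg = \<mu> ^ (CARD('m) - 1) * \<nu>"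
  proof -
    have "det Dg = (\<Prod>i\<in>UNIV. Dg $ i $ i)"
      by (rule det_diagonal) (simp add: Dg_def)
    also have "\<dots> = \<nu> * (\<Prod>i\<in>UNIV - {k}. \<mu>)"
      by (subst prod.remove[of _ k]) (auto simp: Dg_def intro!: prod.cong)
    finally show ?thesis by simp
  qed
  ultimately show ?thesis by simp
qed

text \<open>Both scaling factors differ from 1 by a multiple of \<open>t\<close>: Bernoulli's
  inequality gives \<open>1 - n * t \<le> (1 - t) ^ n \<le> \<nu> \<le> 1\<close>, the middle step
  because \<open>(1 - t) * (1 + t) \<le> 1\<close>.\<close>

lemma squeeze_near:
  fixes e y :: "real^'m"
  assumes e: "norm e = 1" and t: "0 \<le> t" "t \<le> 1" and \<nu>: "\<nu> = inverse ((1 + t) ^ n)"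
  shows "norm (squeeze (1 + t) \<nu> e *v y - y) \<le> (2 + real n) * t * norm y"
proof -
  have "(1 - t) ^ n * (1 + t) ^ n \<le> 1"
  proof -
    have "((1 - t) * (1 + t)) ^ n \<le> 1"
      using t by (intro power_le_one) (auto simp: algebra_simps mult_le_one)
    then show ?thesis by (simp add: power_mult_distrib)
  qed
  then have "(1 - t) ^ n \<le> \<nu>"
    using t by (simp add: \<nu> field_simps)
  moreover have "1 - real n * t \<le> (1 - t) ^ n"
    using Bernoulli_inequality[of "- t" n] t by simp
  moreover have "\<nu> \<le> 1"
    using t by (simp add: \<nu> inverse_le_1_iff one_le_power)
  ultimately have \<nu>': "\<bar>\<nu> - (1 + t)\<bar> \<le> (1 + real n) * t"
    using t by (simp add: abs_le_iff algebra_simps)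
  have "squeeze (1 + t) \<nu> e *v y - y = t *\<^sub>R y + ((\<nu> - (1 + t)) * (e \<bullet> y)) *\<^sub>R e"
    by (simp add: squeeze_mult algebra_simps)
  also have "norm \<dots> \<le> t * norm y + \<bar>\<nu> - (1 + t)\<bar> * \<bar>e \<bullet> y\<bar>"
    using t e by (intro norm_triangle_le) (simp add: abs_mult)
  also have "\<dots> \<le> t * norm y + (1 + real n) * t * norm y"
    using \<nu>' Cauchy_Schwarz_ineq2[of e y] e t by (intro add_left_mono mult_mono) auto
  finally show ?thesis by (simp add: algebra_simps)
qed

section \<open>Components orthogonal to the axis\<close>

abbreviation perp :: "real^'m \<Rightarrow> real^'m \<Rightarrow> real^'m" where
  "perp e x \<equiv> x - (e \<bullet> x) *\<^sub>R e"

lemma perp_scaleR: "perp e (c *\<^sub>R x) = c *\<^sub>R perp e x"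
  by (simp add: scaleR_diff_right)

lemma perp_nonzero: "x \<notin> span {e} \<Longrightarrow> perp e x \<noteq> 0"
  by (auto simp: span_singleton)

lemma norm_perp: assumes "norm e = 1" shows "(norm (perp e x))\<^sup>2 = (norm x)\<^sup>2 - (e \<bullet> x)\<^sup>2"
proof -
  have "e \<bullet> e = 1" using assms by (simp add: dot_square_norm)
  then show ?thesis
    by (simp add: power2_norm_eq_inner inner_diff_left inner_diff_right inner_commute[of x e])
      (simp add: power2_eq_square)
qed

lemma norm_perp_le: assumes "norm e = 1" shows "norm (perp e x) \<le> norm x"
proof (rule power2_le_imp_le)
  show "(norm (perp e x))\<^sup>2 \<le> (norm x)\<^sup>2"
    using norm_perp[OF assms, of x] zero_le_power2[of "e \<bullet> x"] by linarith
qed simp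

lemma perp_squeeze:
  assumes "norm e = 1"
  shows "e \<bullet> (squeeze \<mu> \<nu> e *v x) = \<nu> * (e \<bullet> x)" "perp e (squeeze \<mu> \<nu> e *v x) = \<mu> *\<^sub>R perp e x"
proof -
  have "e \<bullet> e = 1" using assms by (simp add: dot_square_norm)
  then show 1: "e \<bullet> (squeeze \<mu> \<nu> e *v x) = \<nu> * (e \<bullet> x)"
    by (simp add: squeeze_mult inner_add_right algebra_simps)
  show "perp e (squeeze \<mu> \<nu> e *v x) = \<mu> *\<^sub>R perp e x"
    by (simp only: 1) (simp add: squeeze_mult algebra_simps)
qed

text \<open>With \<open>r\<close> and \<open>s\<close> the squared components of \<open>x\<close>
  across and along the axis, the right side is the decrease of
  \<open>(e \<bullet> x)\<^sup>2 / (norm x)\<^sup>2\<close> under squeezing. Over a common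
  denominator the numerator is \<open>r * s * ((1 + t)\<^sup>2 - \<nu>\<^sup>2)\<close>, at least
  \<open>2 * t * r * s\<close>, and the denominator is at most
  \<open>4 * (r + s)\<^sup>2\<close>.\<close>

lemma squeeze_gain:
  fixes t \<nu> r s :: real
  assumes t: "0 < t" "t \<le> 1" and \<nu>: "0 < \<nu>" "\<nu> \<le> 1" and rs: "0 \<le> r" "0 \<le> s" "0 < r + s"
  shows "t * (r * s / (2 * (r + s)\<^sup>2)) \<le> s / (r + s) - \<nu>\<^sup>2 * s / ((1 + t)\<^sup>2 * r + \<nu>\<^sup>2 * s)"
proof -
  define X where "X = r + s"
  define Y where "Y = (1 + t)\<^sup>2 * r + \<nu>\<^sup>2 * s"
  have \<nu>2: "0 < \<nu>\<^sup>2" "\<nu>\<^sup>2 \<le> 1"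
    using \<nu> by (auto simp: power_le_one)
  have mu: "1 + 2 * t \<le> (1 + t)\<^sup>2" "(1 + t)\<^sup>2 \<le> 4"
    using t power_mono[of "1 + t" 2 2] by (auto simp: power2_eq_square algebra_simps)
  have X: "0 < X" using rs by (simp add: X_def)
  have "\<nu>\<^sup>2 * X \<le> Y"
    using \<nu>2 mu t rs by (simp add: X_def Y_def distrib_left mult_right_mono)
  then have Y: "0 < Y" using X \<nu>2 by (meson mult_pos_pos less_le_trans)
  have YX: "Y \<le> 4 * X"
    using \<nu>2 mu rs by (simp add: X_def Y_def distrib_left add_mono mult_right_mono)
  have "s / X - \<nu>\<^sup>2 * s / Y = (s * Y - \<nu>\<^sup>2 * s * X) / (X * Y)"
    using X Y by (simp add: field_simps)
  also have "s * Y - \<nu>\<^sup>2 * s * X = r * s * ((1 + t)\<^sup>2 - \<nu>\<^sup>2)"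
    by (simp add: X_def Y_def algebra_simps)
  also have "r * s * ((1 + t)\<^sup>2 - \<nu>\<^sup>2) / (X * Y) \<ge> r * s * (2 * t) / (X * (4 * X))"
    using rs mu \<nu>2 t X Y YX by (intro frac_le mult_left_mono) auto
  also have "r * s * (2 * t) / (X * (4 * X)) = t * (r * s / (2 * X\<^sup>2))"
    by (simp add: power2_eq_square)
  finally show ?thesis
    by (simp add: X_def Y_def)
qed

section \<open>Nonexistence for the two model right-hand sides\<close>

context
  fixes e :: "real^'m::{finite,wellorder}"
  assumes e: "norm e = 1" and card: "CARD('m) = CARD('n::finite) + 1"
begin

lemma squeeze_family:
  assumes t: "0 < t" "t \<le> 1"
  shows "\<exists>\<nu>. 0 < \<nu> \<and> \<nu> \<le> 1 \<and> det (squeeze (1 + t) \<nu> e) = 1 \<and>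
    (\<forall>y. norm (squeeze (1 + t) \<nu> e *v y - y) \<le> (2 + real CARD('n)) * t * norm y)"
proof (intro exI conjI allI)
  let ?\<nu> = "inverse ((1 + t) ^ CARD('n))"
  show "0 < ?\<nu>" "?\<nu> \<le> 1"
    using t by (simp_all add: inverse_le_1_iff)
  show "det (squeeze (1 + t) ?\<nu> e) = 1"
    using t by (simp add: det_squeeze[OF e] card)
  show "norm (squeeze (1 + t) ?\<nu> e *v y - y) \<le> (2 + real CARD('n)) * t * norm y" for y
    by (rule squeeze_near[OF e]) (use t in simp_all)
qed

lemma perp_exists: obtains a where "a \<noteq> 0" "e \<bullet> a = 0"
proof -
  have "2 \<le> DIM(real^'m::{finite,wellorder})"
    using card by (simp add: Suc_le_eq)
  then show ?thesis
    using that orthogonal_to_vector_exists[of e] by (auto simp: orthogonal_def)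
qed

text \<open>The density \<open>w\<close> is \<open>norm (perp e x) powr q\<close> itself, which
  squeezing multiplies by \<open>(1 + t) powr q\<close>. This gives a first-order gain proportional
  to \<open>w\<close>, positive along a ray orthogonal to the axis.\<close>

lemma no_solution_supercritical:
  assumes "0 < q"
  shows "\<not> Lp_Minkowski_solution TYPE('n) (- real CARD('m) - q) (\<lambda>x. norm (perp e x) powr q) h"
proof
  let ?f = "\<lambda>x. norm (perp e x) powr q"
  assume "Lp_Minkowski_solution TYPE('n) (- real CARD('m) - q) ?f h"
  then obtain G M D where
    "monge_ampere_potential G M D (2 + q / CARD('m)) (\<lambda>x. norm x powr q * ?f (x /\<^sub>R norm x)) e"
    by (rule monge_ampere_potential_of_solution[OF _ card, where q = q and e = e])
      (use assms perp_nonzero in \<open>simp, simp, simp, metis norm_eq_zero powr_gt_zero\<close>)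
  moreover have "(\<lambda>x. norm x powr q * ?f (x /\<^sub>R norm x)) = ?f"
  proof
    fix x
    have "norm x *\<^sub>R perp e (x /\<^sub>R norm x) = perp e x"
      by (cases "x = 0") (simp, subst perp_scaleR[symmetric], simp)
    from arg_cong[OF this, of norm]
    have "norm (perp e x) = norm x * norm (perp e (x /\<^sub>R norm x))"
      by (simp only: norm_scaleR abs_norm_cancel)
    then show "norm x powr q * ?f (x /\<^sub>R norm x) = ?f x"
      by (simp only: powr_mult norm_ge_zero)
  qed
  ultimately have pot: "monge_ampere_potential G M D (2 + q / CARD('m)) ?f e"
    by simp
  have f_cont: "continuous_on S ?f" for S
    using assms by (intro continuous_on_powr' continuous_intros) auto
  interpret monge_ampere_potential_continuous G M D "2 + q / CARD('m)" ?f e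
  proof (intro monge_ampere_potential_continuous.intro monge_ampere_potential_continuous_axioms.intro pot f_cont)
    show "\<exists>B. \<forall>x. x \<noteq> 0 \<longrightarrow> norm x \<le> R \<longrightarrow> ?f x \<le> B" for R
      using assms norm_perp_le[OF e]
      by (intro exI[of _ "R powr q"]) (auto intro!: powr_mono2 intro: order_trans)
  qed
  obtain a where a: "a \<noteq> 0" "e \<bullet> a = 0"
    using perp_exists by blast
  have "\<not> (\<forall>t. 0 < t \<longrightarrow> t \<le> 1 \<longrightarrow> (\<exists>B. det B = 1 \<and> transpose B = B \<and>
      (\<forall>y. norm (B *v y - y) \<le> (2 + real CARD('n)) * t * norm y) \<and>
      (\<forall>x. x \<noteq> 0 \<longrightarrow> ?f x + t * (q / 2 * ?f x) \<le> ?f (B *v x))))"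
    by (rule no_first_order_increase[where a = a and C = "q / 2"])
      (rule continuous_on_mult_left[OF f_cont] | use assms a in simp)+
  moreover have "\<exists>B. det B = 1 \<and> transpose B = B \<and>
      (\<forall>y. norm (B *v y - y) \<le> (2 + real CARD('n)) * t * norm y) \<and>
      (\<forall>x. x \<noteq> 0 \<longrightarrow> ?f x + t * (q / 2 * ?f x) \<le> ?f (B *v x))"
    if t: "0 < t" "t \<le> 1" for t
  proof -
    obtain \<nu> where \<nu>: "0 < \<nu>" "\<nu> \<le> 1" "det (squeeze (1 + t) \<nu> e) = 1"
      "\<And>y. norm (squeeze (1 + t) \<nu> e *v y - y) \<le> (2 + real CARD('n)) * t * norm y"
      using squeeze_family[OF t] by metis
    \<comment> \<open>For \<open>0 < t \<le> 1\<close> the logarithm satisfies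
      \<open>ln (1 + t) \<ge> t / (1 + t) \<ge> t / 2\<close>; then
      \<open>exp u \<ge> 1 + u\<close>.\<close>
    have "1 + t * q / 2 \<le> (1 + t) powr q"
    proof -
      have "t / 2 \<le> t / (1 + t)"
        using t by (intro frac_le) auto
      also have "\<dots> = 1 - 1 / (1 + t)"
        using t by (simp add: field_simps)
      also have "\<dots> \<le> ln (1 + t)"
        using ln_le_minus_one[of "1 / (1 + t)"] ln_div[of 1 "1 + t"] t by simp
      finally have "t * q / 2 \<le> q * ln (1 + t)"
        using assms by (simp add: field_simps)
      then have "1 + t * q / 2 \<le> exp (q * ln (1 + t))"
        using exp_ge_add_one_self[of "q * ln (1 + t)"] by linarith
      then show ?thesis
        using t by (simp add: powr_def)
    qed
    then have "(1 + t * q / 2) * ?f x \<le> (1 + t) powr q * ?f x" for x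
      by (rule mult_right_mono) simp
    moreover have "?f (squeeze (1 + t) \<nu> e *v x) = (1 + t) powr q * ?f x" for x
      unfolding perp_squeeze(2)[OF e] norm_scaleR using t by (simp add: powr_mult)
    ultimately have "?f x + t * (q / 2 * ?f x) \<le> ?f (squeeze (1 + t) \<nu> e *v x)" for x
      by (simp add: algebra_simps)
    with \<nu> show ?thesis
      using transpose_squeeze by blast
  qed
  ultimately show False by blast
qed

text \<open>Here \<open>q = 0\<close> and \<open>\<beta> = 2\<close>, so the density is
  0-homogeneous. Squeezing turns directions away from the axis and increases it, with the
  first-order gain given by \<open>squeeze_gain\<close>.\<close>

lemma no_solution_critical:
  "\<not> Lp_Minkowski_solution TYPE('n) (- real CARD('m)) (\<lambda>x. 2 - (e \<bullet> x)\<^sup>2) h"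
proof
  let ?f = "\<lambda>x. 2 - (e \<bullet> x)\<^sup>2"
  define w where "w x = norm x powr 0 * ?f (x /\<^sub>R norm x)" for x
  assume sol: "Lp_Minkowski_solution TYPE('n) (- real CARD('m)) ?f h"
  have f1: "1 \<le> ?f x" if "norm x = 1" for x
    using norm_perp[OF e, of x] that by (smt (verit) one_power2 zero_le_power2)
  obtain G M D where pot: "monge_ampere_potential G M D (2 + 0 / CARD('m)) w e"
    unfolding w_def[abs_def]
    by (rule monge_ampere_potential_of_solution[OF sol card, where q = 0 and e = e])
      (use f1 in \<open>force+\<close>)
  have w: "w x = 2 - (e \<bullet> x)\<^sup>2 / (norm x)\<^sup>2" if "x \<noteq> 0" for x
    using that by (simp add: w_def power_mult_distrib divide_inverse power_inverse mult.commute)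
  have w1: "1 \<le> w x" and w2: "w x \<le> 2" if "x \<noteq> 0" for x
    using f1[of "x /\<^sub>R norm x"] that by (simp_all add: w_def)
  have w_cont: "continuous_on (- {0}) w"
    by (rule continuous_on_eq[of _ "\<lambda>x. 2 - (e \<bullet> x)\<^sup>2 / (norm x)\<^sup>2"])
      (auto intro!: continuous_intros simp: w)
  interpret monge_ampere_potential_continuous G M D "2 + 0 / CARD('m)" w e
    by (intro monge_ampere_potential_continuous.intro monge_ampere_potential_continuous_axioms.intro pot w_cont)
      (use w2 in blast)
  \<comment> \<open>The gain of \<open>squeeze_gain\<close>. It vanishes on the axis and on the
    equator, so positivity is tested on the ray through \<open>e + a\<close>, which lies in
    neither.\<close>
  define v where "v x = (norm (perp e x))\<^sup>2 * (e \<bullet> x)\<^sup>2 / (2 * ((norm x)\<^sup>2)\<^sup>2)" for x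
  obtain a where a: "a \<noteq> 0" "e \<bullet> a = 0"
    using perp_exists by blast
  have ee: "e \<bullet> e = 1" using e by (simp add: dot_square_norm)
  have ea: "e + a \<noteq> 0" "e \<bullet> (e + a) = 1"
    using a ee by (auto simp: inner_add_right add_eq_0_iff)
  have perp_ea: "perp e (s *\<^sub>R (e + a)) = s *\<^sub>R a" for s
    using a ee by (simp add: inner_add_right algebra_simps)
  have "\<not> (\<forall>t. 0 < t \<longrightarrow> t \<le> 1 \<longrightarrow> (\<exists>B. det B = 1 \<and> transpose B = B \<and>
      (\<forall>y. norm (B *v y - y) \<le> (2 + real CARD('n)) * t * norm y) \<and>
      (\<forall>x. x \<noteq> 0 \<longrightarrow> w x + t * v x \<le> w (B *v x))))"
  proof (rule no_first_order_increase[where a = "e + a" and C = 1])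
    show "continuous_on (- {0}) v"
      unfolding v_def[abs_def] by (auto intro!: continuous_intros)
    show "0 \<le> v x" for x by (simp add: v_def)
    show "0 < v (s *\<^sub>R (e + a))" if "0 < s" for s
      unfolding v_def perp_ea using that a ea by simp
    show "v x \<le> 1 * w x" if "x \<noteq> 0" for x
    proof -
      have "(norm (perp e x))\<^sup>2 * (e \<bullet> x)\<^sup>2 \<le> (norm x)\<^sup>2 * (norm x)\<^sup>2"
      proof (rule mult_mono)
        show "(norm (perp e x))\<^sup>2 \<le> (norm x)\<^sup>2" "(e \<bullet> x)\<^sup>2 \<le> (norm x)\<^sup>2"
          using norm_perp[OF e, of x] zero_le_power2[of "norm (perp e x)"] zero_le_power2[of "e \<bullet> x"]
          by linarith+
      qed simp_all
      also have "\<dots> \<le> 1 * (2 * ((norm x)\<^sup>2)\<^sup>2)"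
        unfolding power2_eq_square[of "(norm x)\<^sup>2"] by simp
      finally have "v x \<le> 1"
        unfolding v_def using that by (subst pos_divide_le_eq) simp_all
      then show ?thesis using w1[OF that] by simp
    qed
  qed (rule ea(1))
  moreover have "\<exists>B. det B = 1 \<and> transpose B = B \<and>
      (\<forall>y. norm (B *v y - y) \<le> (2 + real CARD('n)) * t * norm y) \<and>
      (\<forall>x. x \<noteq> 0 \<longrightarrow> w x + t * v x \<le> w (B *v x))"
    if t: "0 < t" "t \<le> 1" for t
  proof -
    obtain \<nu> where \<nu>: "0 < \<nu>" "\<nu> \<le> 1" "det (squeeze (1 + t) \<nu> e) = 1"
      "\<And>y. norm (squeeze (1 + t) \<nu> e *v y - y) \<le> (2 + real CARD('n)) * t * norm y"
      using squeeze_family[OF t] by metis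
    let ?B = "squeeze (1 + t) \<nu> e"
    have "w x + t * v x \<le> w (?B *v x)" if x: "x \<noteq> 0" for x
    proof -
      have Bx: "?B *v x \<noteq> 0"
        using \<nu>(3) x by (metis invertible_det_nz invertible_left_inverse matrix_left_invertible_ker zero_neq_one)
      define r where "r = (norm (perp e x))\<^sup>2"
      define s where "s = (e \<bullet> x)\<^sup>2"
      have nx: "(norm x)\<^sup>2 = r + s"
        using norm_perp[OF e, of x] by (simp add: r_def s_def)
      have nBx: "(norm (?B *v x))\<^sup>2 = (1 + t)\<^sup>2 * r + \<nu>\<^sup>2 * s"
        using norm_perp[OF e, of "?B *v x"] unfolding perp_squeeze(2)[OF e] unfolding perp_squeeze(1)[OF e]
        by (simp add: r_def s_def power_mult_distrib)
      have "t * (r * s / (2 * (r + s)\<^sup>2)) \<le> s / (r + s) - \<nu>\<^sup>2 * s / ((1 + t)\<^sup>2 * r + \<nu>\<^sup>2 * s)"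
      proof (rule squeeze_gain)
        show "0 < r + s" using x by (simp flip: nx)
      qed (use t \<nu> in \<open>simp_all add: r_def s_def\<close>)
      moreover have "w x = 2 - s / (r + s)" "v x = r * s / (2 * (r + s)\<^sup>2)"
        using x by (simp_all add: w v_def nx flip: r_def s_def)
      moreover have "w (?B *v x) = 2 - \<nu>\<^sup>2 * s / ((1 + t)\<^sup>2 * r + \<nu>\<^sup>2 * s)"
        using Bx by (simp add: w nBx perp_squeeze[OF e] power_mult_distrib s_def)
      ultimately show ?thesis by simp
    qed
    with \<nu> show ?thesis
      using transpose_squeeze by blast
  qed
  ultimately show False by blast
qed

end

section \<open>Well-ordered coordinates\<close>

text \<open>The change of variables theorem of HOL-Analysis is only available for well-ordered index types,
  so the problem is moved from the finite type \<open>'m\<close> to this well-ordered copy.\<close>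

typedef 'a enumerated = "UNIV :: 'a set" morphisms unenum enum by auto

instance enumerated :: (finite) finite
proof
  have "(UNIV :: 'a enumerated set) = range enum"
    by (metis UNIV_I image_eqI subsetI top.extremum_uniqueI unenum_inverse)
  then show "finite (UNIV :: 'a enumerated set)"
    by (metis finite_imageI finite)
qed

instantiation enumerated :: (finite) wellorder
begin

definition less_eq_enumerated :: "'a enumerated \<Rightarrow> 'a enumerated \<Rightarrow> bool" where
  "x \<le> y \<longleftrightarrow> to_nat (unenum x) \<le> to_nat (unenum y)"

definition less_enumerated :: "'a enumerated \<Rightarrow> 'a enumerated \<Rightarrow> bool" where
  "x < y \<longleftrightarrow> to_nat (unenum x) < to_nat (unenum y)"

instance
proof
  fix P :: "'a enumerated \<Rightarrow> bool" and a :: "'a enumerated"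
  assume step: "\<And>x. (\<And>y. y < x \<Longrightarrow> P y) \<Longrightarrow> P x"
  show "P a"
    by (induction a rule: measure_induct_rule[of "\<lambda>x. to_nat (unenum x)"])
      (rule step, simp add: less_enumerated_def)
qed (auto simp: less_eq_enumerated_def less_enumerated_def unenum_inject)

end

lemma bij_enum: "bij enum"
  by (metis bij_iff enum_inverse iso_tuple_UNIV_I unenum_inverse)

lemma CARD_enumerated: "CARD('a enumerated) = CARD('a)"
  using bij_enum bij_betw_same_card by metis

text \<open>Relabelling coordinates is a linear isometry \<open>P\<close> with inverse and adjoint
  \<open>Q\<close>. The Hessian becomes \<open>Q\<close> after \<open>H (P x)\<close> after
  \<open>P\<close>, and orthonormal frames at \<open>x\<close> are carried to frames at
  \<open>P x\<close>, so every condition is preserved.\<close>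

lemma Lp_Minkowski_solution_reindex:
  fixes \<phi> :: "'m::finite \<Rightarrow> 'k::finite"
  assumes \<phi>: "bij \<phi>" and sol: "Lp_Minkowski_solution TYPE('n::finite) p f h"
  defines "P \<equiv> \<lambda>x::real^'k. \<chi> i. x $ \<phi> i"
  shows "Lp_Minkowski_solution TYPE('n) p (f \<circ> P) (h \<circ> P)"
proof -
  define Q where "Q y = (\<chi> j. y $ inv \<phi> j)" for y :: "real^'m"
  have inv: "inv \<phi> (\<phi> i) = i" "\<phi> (inv \<phi> j) = j" for i j
    using \<phi> by (simp_all add: bij_is_inj bij_is_surj surj_f_inv_f)
  have PQ [simp]: "P (Q y) = y" "Q (P x) = x" for x y
    by (simp_all add: P_def Q_def inv vec_eq_iff)
  have P_linear: "linear P" and Q_linear: "linear Q"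
    by (auto intro!: linearI simp: P_def Q_def vec_eq_iff)
  have dotQ: "Q y \<bullet> x = y \<bullet> P x" for x y
  proof -
    have "Q y \<bullet> x = (\<Sum>j\<in>UNIV. y $ inv \<phi> j * x $ j)"
      by (simp add: inner_vec_def Q_def)
    also have "\<dots> = (\<Sum>i\<in>UNIV. y $ inv \<phi> (\<phi> i) * x $ \<phi> i)"
      by (rule sum.reindex_bij_betw[OF \<phi>, symmetric])
    finally show ?thesis by (simp add: inv inner_vec_def P_def)
  qed
  have dotP: "P x \<bullet> P y = x \<bullet> y" for x y
    using dotQ[of "P x" y] by simp
  have normP: "norm (P x) = norm x" for x
    by (simp add: norm_eq_sqrt_inner dotP)
  have P0: "P x \<noteq> 0" if "x \<noteq> 0" for x
    using normP[of x] that by (metis norm_eq_zero)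
  have P_der: "(P has_derivative P) (at x)" for x
    using P_linear linear_conv_bounded_linear bounded_linear_imp_has_derivative by blast
  have Q_bl: "bounded_linear Q"
    using Q_linear linear_conv_bounded_linear by blast
  have hom0P: "hom0 (h \<circ> P) x = hom0 h (P x)" for x
    by (simp add: hom0_def normP linear_cmul[OF P_linear])
  obtain H where H: "C2_sphere_hess h H"
    and sol': "\<forall>x\<in>sphere 0 1. h x > 0 \<and>
      (\<forall>v. v \<bullet> x = 0 \<longrightarrow> v \<bullet> (H x *v v) + h x * (v \<bullet> v) \<ge> 0) \<and>
      (\<forall>e :: 'n \<Rightarrow> real^'m. sphere_frame x e \<longrightarrow>
        det (\<chi> i j. e i \<bullet> (H x *v e j) + (if i = j then h x else 0)) = f x * h x powr (p - 1))"
    using sol unfolding Lp_Minkowski_solution_def by blast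
  obtain g where k_der: "\<And>x. x \<noteq> 0 \<Longrightarrow> (hom0 h has_derivative (\<lambda>v. g x \<bullet> v)) (at x)"
    and g_der: "\<And>x. x \<noteq> 0 \<Longrightarrow> (g has_derivative (\<lambda>v. H x *v v)) (at x)"
    and H_cont: "continuous_on (- {0}) H"
    using H unfolding C2_sphere_hess_def by blast
  define H' where "H' x = (\<chi> i j. H (P x) $ inv \<phi> i $ inv \<phi> j)" for x
  have H': "H' x *v v = Q (H (P x) *v P v)" for x v
  proof -
    have "(H' x *v v) $ i = (H (P x) *v P v) $ inv \<phi> i" for i
    proof -
      have "(H' x *v v) $ i = (\<Sum>j\<in>UNIV. H (P x) $ inv \<phi> i $ inv \<phi> j * v $ j)"
        by (simp add: H'_def matrix_vector_mult_def)
      also have "\<dots> = (\<Sum>l\<in>UNIV. H (P x) $ inv \<phi> i $ inv \<phi> (\<phi> l) * v $ \<phi> l)"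
        by (rule sum.reindex_bij_betw[OF \<phi>, symmetric])
      finally show ?thesis by (simp add: inv matrix_vector_mult_def P_def)
    qed
    then show ?thesis by (simp add: vec_eq_iff Q_def)
  qed
  have "C2_sphere_hess (h \<circ> P) H'"
    unfolding C2_sphere_hess_def
  proof (intro conjI exI[of _ "\<lambda>x. Q (g (P x))"] allI impI)
    fix x :: "real^'k" assume x: "x \<noteq> 0"
    have "((\<lambda>x. hom0 h (P x)) has_derivative (\<lambda>v. g (P x) \<bullet> P v)) (at x)"
      by (rule has_derivative_compose[OF P_der k_der[OF P0[OF x]]])
    then show "(hom0 (h \<circ> P) has_derivative (\<lambda>v. Q (g (P x)) \<bullet> v)) (at x)"
      by (simp add: dotQ hom0P[abs_def])
    have "((\<lambda>x. g (P x)) has_derivative (\<lambda>v. H (P x) *v P v)) (at x)"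
      by (rule has_derivative_compose[OF P_der g_der[OF P0[OF x]]])
    from bounded_linear.has_derivative[OF Q_bl this]
    show "((\<lambda>x. Q (g (P x))) has_derivative (\<lambda>v. H' x *v v)) (at x)"
      by (simp add: H')
  next
    have "bounded_linear P"
      using P_linear linear_conv_bounded_linear by blast
    then have "continuous_on (- {0}) (\<lambda>x. H (P x))"
      by (rule continuous_on_compose2[OF H_cont linear_continuous_on]) (rule image_subsetI, simp add: P0)
    then show "continuous_on (- {0}) H'"
      unfolding H'_def[abs_def] by (intro continuous_intros continuous_on_vec_lambda)
  qed
  moreover have "0 < (h \<circ> P) x \<and>
      (\<forall>v. v \<bullet> x = 0 \<longrightarrow> v \<bullet> (H' x *v v) + (h \<circ> P) x * (v \<bullet> v) \<ge> 0) \<and>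
      (\<forall>e :: 'n \<Rightarrow> real^'k. sphere_frame x e \<longrightarrow>
        det (\<chi> i j. e i \<bullet> (H' x *v e j) + (if i = j then (h \<circ> P) x else 0)) = (f \<circ> P) x * (h \<circ> P) x powr (p - 1))"
    if "x \<in> sphere 0 1" for x
  proof -
    have x: "P x \<in> sphere 0 1" using that by (simp add: normP)
    have dotH: "u \<bullet> (H' x *v v) = P u \<bullet> (H (P x) *v P v)" for u v
      unfolding H' by (metis dotQ inner_commute)
    note X = bspec[OF sol' x]
    show ?thesis
    proof (intro conjI allI impI)
      show "0 < (h \<circ> P) x" using X by simp
      show "v \<bullet> (H' x *v v) + (h \<circ> P) x * (v \<bullet> v) \<ge> 0" if "v \<bullet> x = 0" for v
        using X[THEN conjunct2, THEN conjunct1, rule_format, of "P v"] that by (simp add: dotH dotP)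
      fix e :: "'n \<Rightarrow> real^'k" assume "sphere_frame x e"
      then have "sphere_frame (P x) (\<lambda>i. P (e i))"
        by (simp add: sphere_frame_def dotP)
      from X[THEN conjunct2, THEN conjunct2, rule_format, OF this]
      show "det (\<chi> i j. e i \<bullet> (H' x *v e j) + (if i = j then (h \<circ> P) x else 0)) = (f \<circ> P) x * (h \<circ> P) x powr (p - 1)"
        unfolding dotH comp_apply .
    qed
  qed
  ultimately show ?thesis
    unfolding Lp_Minkowski_solution_def by blast
qed

section \<open>Hoelder continuity\<close>

text \<open>After division by \<open>a\<close> this is
  \<open>1 \<le> c powr q + (1 - c) powr q\<close> with \<open>c = b / a\<close>, which holds
  because a power with exponent at most 1 does not decrease numbers in the unit interval.\<close>

lemma powr_diff_le_powr:
  fixes a b q :: real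
  assumes q: "0 < q" "q \<le> 1" and ab: "0 \<le> b" "b \<le> a"
  shows "a powr q - b powr q \<le> (a - b) powr q"
proof (cases "a = 0")
  case False
  then have a: "0 < a" using ab by simp
  have le: "c \<le> c powr q" if "0 \<le> c" "c \<le> 1" for c
    using powr_mono'[of q 1 c] q that by simp
  have "1 = (a - b) / a + b / a"
    using a by (simp add: field_simps)
  also have "\<dots> \<le> ((a - b) / a) powr q + (b / a) powr q"
    using a ab by (intro add_mono le) (auto simp: field_simps)
  also have "\<dots> = ((a - b) powr q + b powr q) / a powr q"
    using a ab by (simp add: powr_divide add_divide_distrib)
  finally show ?thesis
    using a by (simp add: field_simps)
qed (use ab in simp)

lemma powr_diff_le_linear:
  fixes a b q :: real
  assumes q: "1 \<le> q" and ab: "0 \<le> b" "b \<le> a" "a \<le> 1"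
  shows "a powr q - b powr q \<le> q * (a - b)"
proof (cases "b < a")
  case True
  have "\<exists>l z. b < z \<and> z < a \<and> ((\<lambda>z. z powr q) has_real_derivative l) (at z) \<and> a powr q - b powr q = (a - b) * l"
  proof (rule MVT[OF True])
    show "continuous_on {b..a} (\<lambda>z. z powr q)"
      using ab q by (intro continuous_on_powr' continuous_intros) auto
    show "(\<lambda>z. z powr q) differentiable (at z)" if "b < z" "z < a" for z
      unfolding real_differentiable_def
      using that ab by (intro exI[of _ "q * z powr (q - 1)"]) (auto intro!: derivative_eq_intros)
  qed
  then obtain l z where z: "b < z" "z < a" "((\<lambda>z. z powr q) has_real_derivative l) (at z)"
    "a powr q - b powr q = (a - b) * l"
    by blast
  have "((\<lambda>z. z powr q) has_real_derivative q * z powr (q - 1)) (at z)"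
    using z ab by (auto intro!: derivative_eq_intros)
  then have l: "l = q * z powr (q - 1)"
    using z(3) DERIV_unique by blast
  have "z powr (q - 1) \<le> 1"
    using z ab q by (intro powr_le1) auto
  then have "l \<le> q" using q by (simp add: l mult_left_le)
  then have "(a - b) * l \<le> (a - b) * q"
    using True by (intro mult_left_mono) auto
  then show ?thesis by (simp add: z mult.commute)
qed (use ab in simp)

lemma powr_holder:
  fixes a b q :: real
  assumes q: "0 < q" and a: "0 \<le> a" "a \<le> 1" and b: "0 \<le> b" "b \<le> 1"
  shows "\<bar>a powr q - b powr q\<bar> \<le> max 1 q * \<bar>a - b\<bar> powr min 1 q"
proof -
  have *: "\<bar>c powr q - d powr q\<bar> \<le> max 1 q * \<bar>c - d\<bar> powr min 1 q"
    if "0 \<le> d" "d \<le> c" "c \<le> 1" for c d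
  proof (cases "q \<le> 1")
    case True
    then show ?thesis
      using powr_diff_le_powr[OF q True that(1,2)] that powr_mono2[of q d c] q
      by (simp add: min_def max_def)
  next
    case False
    then show ?thesis
      using powr_diff_le_linear[of q d c] that powr_mono2[of q d c]
      by (simp add: min_def max_def)
  qed
  show ?thesis
    using *[of b a] *[of a b] a b by (cases "b \<le> a") (simp_all add: abs_minus_commute)
qed

text \<open>The function is Lipschitz with constant 2. The exponent is lowered to
  \<open>1 / 2\<close>, to be strictly below 1, by
  \<open>d = sqrt d * sqrt d \<le> 2 * sqrt d\<close> for distances \<open>d \<le> 2\<close>; this
  gives the constant 4.\<close>

lemma holder_on_critical:
  fixes e :: "real^'m"
  assumes "norm e = 1"
  shows "holder_on (1 / 2) (sphere 0 1) (\<lambda>x. 2 - (e \<bullet> x)\<^sup>2)"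
  unfolding holder_on_def
proof (intro exI[of _ 4] ballI)
  fix x y :: "real^'m" assume x: "x \<in> sphere 0 1" and y: "y \<in> sphere 0 1"
  define d where "d = dist x y"
  have d: "0 \<le> d" "d \<le> 2"
    using norm_triangle_ineq4[of x y] x y by (auto simp: d_def dist_norm)
  have b: "\<bar>e \<bullet> x\<bar> \<le> 1" "\<bar>e \<bullet> y\<bar> \<le> 1" "\<bar>e \<bullet> (y - x)\<bar> \<le> d"
    using Cauchy_Schwarz_ineq2[of e x] Cauchy_Schwarz_ineq2[of e y] Cauchy_Schwarz_ineq2[of e "y - x"] assms x y
    by (auto simp: d_def dist_norm norm_minus_commute)
  have "\<bar>2 - (e \<bullet> x)\<^sup>2 - (2 - (e \<bullet> y)\<^sup>2)\<bar> = \<bar>e \<bullet> (y - x)\<bar> * \<bar>e \<bullet> y + e \<bullet> x\<bar>"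
    unfolding abs_mult[symmetric] by (simp add: inner_diff_right power2_eq_square algebra_simps)
  also have "\<dots> \<le> d * 2"
    using b d by (intro mult_mono) auto
  also have "\<dots> = 2 * (sqrt d * sqrt d)"
    using d by simp
  also have "\<dots> \<le> 2 * (2 * sqrt d)"
    using d real_le_lsqrt[of 2 d] real_sqrt_le_mono[of d 4] by (intro mult_left_mono mult_right_mono) auto
  finally show "\<bar>2 - (e \<bullet> x)\<^sup>2 - (2 - (e \<bullet> y)\<^sup>2)\<bar> \<le> 4 * dist x y powr (1 / 2)"
    using d by (simp add: powr_half_sqrt flip: d_def)
qed

text \<open>The norm of the orthogonal component is 1-Lipschitz with values in the unit interval on
  the sphere, where the power function is Hoelder with exponent \<open>min 1 q\<close>.\<close>

lemma holder_on_supercritical: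
  fixes e :: "real^'m"
  assumes e: "norm e = 1" and q: "0 < q"
  shows "holder_on (min 1 q) (sphere 0 1) (\<lambda>x. norm (perp e x) powr q)"
  unfolding holder_on_def
proof (intro exI[of _ "max 1 q"] ballI)
  fix x y :: "real^'m" assume x: "x \<in> sphere 0 1" and y: "y \<in> sphere 0 1"
  have "\<bar>norm (perp e x) powr q - norm (perp e y) powr q\<bar>
      \<le> max 1 q * \<bar>norm (perp e x) - norm (perp e y)\<bar> powr min 1 q"
    using norm_perp_le[OF e, of x] norm_perp_le[OF e, of y] x y by (intro powr_holder q) auto
  also have "\<bar>norm (perp e x) - norm (perp e y)\<bar> \<le> dist x y"
  proof -
    have "\<bar>norm (perp e x) - norm (perp e y)\<bar> \<le> norm (perp e x - perp e y)"
      by (rule norm_triangle_ineq3)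
    also have "perp e x - perp e y = perp e (x - y)"
      by (simp add: inner_diff_right algebra_simps)
    also have "norm \<dots> \<le> dist x y"
      using norm_perp_le[OF e] by (simp add: dist_norm)
    finally show ?thesis .
  qed
  then have "max 1 q * \<bar>norm (perp e x) - norm (perp e y)\<bar> powr min 1 q \<le> max 1 q * dist x y powr min 1 q"
    using q by (intro mult_left_mono powr_mono2) auto
  finally show "\<bar>norm (perp e x) powr q - norm (perp e y) powr q\<bar> \<le> max 1 q * dist x y powr min 1 q" .
qed

section \<open>The poles and the conclusion in the original coordinates\<close>

lemma span_inter_sphere: "norm x = 1 \<Longrightarrow> norm e = 1 \<Longrightarrow> x \<in> span {e} \<Longrightarrow> x = e \<or> x = - e"
  for x e :: "real^'m"
  by (auto simp: span_singleton abs_if split: if_splits)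

theorem theorem1p1:
  fixes p :: real and e :: "real^'m"
  assumes dim: "CARD('m) = CARD('n::finite) + 1"
    and e: "norm e = 1"
  shows "(p = - real CARD('n) - 1 \<longrightarrow>
            (\<exists>\<alpha> (f :: real^'m \<Rightarrow> real). 0 < \<alpha> \<and> \<alpha> < 1 \<and> holder_on \<alpha> (sphere 0 1) f \<and>
                   (\<forall>x \<in> sphere 0 1. f x > 0) \<and>
                   \<not> (\<exists>h. Lp_Minkowski_solution TYPE('n) p f h)))
       \<and> (p < - real CARD('n) - 1 \<longrightarrow>
            (\<exists>\<alpha> (f :: real^'m \<Rightarrow> real). 0 < \<alpha> \<and> \<alpha> \<le> 1 \<and> holder_on \<alpha> (sphere 0 1) f \<and>
                   (\<forall>x \<in> sphere 0 1 - {e, - e}. f x > 0) \<and>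
                   \<not> (\<exists>h. Lp_Minkowski_solution TYPE('n) p f h)))"
proof -
  \<comment> \<open>\<open>P\<close> relabels coordinates isometrically and \<open>e'\<close> is the
    preimage of \<open>e\<close>. Both model functions depend only on \<open>e \<bullet> x\<close>
    and on the norm of the orthogonal component, so composing them with \<open>P\<close> gives the
    same functions for \<open>e'\<close>.\<close>
  define \<phi> :: "'m \<Rightarrow> 'm enumerated" where "\<phi> = enum"
  have \<phi>: "bij \<phi>"
    unfolding \<phi>_def by (rule bij_enum)
  define P :: "real^'m enumerated \<Rightarrow> real^'m" where "P x = (\<chi> i. x $ \<phi> i)" for x
  define e' :: "real^'m enumerated" where "e' = (\<chi> j. e $ inv \<phi> j)"
  have P_linear: "linear P"
    by (auto intro!: linearI simp: P_def vec_eq_iff)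
  have P_inner: "P x \<bullet> P y = x \<bullet> y" for x y
    unfolding P_def inner_vec_def using sum.reindex_bij_betw[OF \<phi>, of "\<lambda>j. x $ j \<bullet> y $ j"] by simp
  have Pe: "P e' = e"
    using \<phi> by (simp add: P_def e'_def vec_eq_iff bij_is_inj)
  have P_norm: "norm (P x) = norm x" for x
    by (simp add: norm_eq_sqrt_inner P_inner)
  have e': "norm e' = 1"
    using P_norm[of e'] Pe e by simp
  have P_dot: "e \<bullet> P x = e' \<bullet> x" for x
    using P_inner[of e' x] Pe by simp
  have P_perp: "norm (perp e (P x)) = norm (perp e' x)" for x
  proof -
    have "perp e (P x) = P (perp e' x)"
      by (simp add: P_dot linear_diff[OF P_linear] linear_cmul[OF P_linear] Pe)
    then show ?thesis by (simp add: P_norm)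
  qed
  have card': "CARD('m enumerated) = CARD('n) + 1"
    using dim by (simp add: CARD_enumerated)
  have reindex: "Lp_Minkowski_solution TYPE('n) p (f \<circ> P) (h \<circ> P)" if "Lp_Minkowski_solution TYPE('n) p f h" for f h
    using Lp_Minkowski_solution_reindex[OF \<phi> that] by (simp add: P_def[abs_def])
  show ?thesis
  proof (intro conjI impI)
    assume "p = - real CARD('n) - 1"
    then have pm: "p = - real CARD('m enumerated)"
      unfolding card' by simp
    let ?f = "\<lambda>x. 2 - (e \<bullet> x)\<^sup>2"
    have "\<not> Lp_Minkowski_solution TYPE('n) p ?f h" for h
    proof
      assume "Lp_Minkowski_solution TYPE('n) p ?f h"
      from reindex[OF this] no_solution_critical[OF e' card', of "h \<circ> P"]
      show False unfolding pm[symmetric] o_def P_dot by blast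
    qed
    moreover have "0 < ?f x" if "x \<in> sphere 0 1" for x
      using norm_perp[OF e, of x] that zero_le_power2[of "norm (perp e x)"] by simp
    ultimately show "\<exists>\<alpha> (f :: real^'m \<Rightarrow> real). 0 < \<alpha> \<and> \<alpha> < 1 \<and> holder_on \<alpha> (sphere 0 1) f \<and>
        (\<forall>x \<in> sphere 0 1. f x > 0) \<and> \<not> (\<exists>h. Lp_Minkowski_solution TYPE('n) p f h)"
      using holder_on_critical[OF e] by (intro exI[of _ "1 / 2"] exI[of _ ?f]) auto
  next
    assume p: "p < - real CARD('n) - 1"
    define q where "q = - p - real CARD('n) - 1"
    have q: "0 < q" using p by (simp add: q_def)
    have pq: "p = - real CARD('m enumerated) - q"
      unfolding card' by (simp add: q_def)
    let ?f = "\<lambda>x. norm (perp e x) powr q"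
    have "\<not> Lp_Minkowski_solution TYPE('n) p ?f h" for h
    proof
      assume "Lp_Minkowski_solution TYPE('n) p ?f h"
      from reindex[OF this] no_solution_supercritical[OF e' card' q, of "h \<circ> P"]
      show False unfolding pq[symmetric] o_def P_perp by blast
    qed
    moreover have "0 < ?f x" if "x \<in> sphere 0 1 - {e, - e}" for x
      using that span_inter_sphere[of x e] perp_nonzero[of x e] e by auto
    ultimately show "\<exists>\<alpha> (f :: real^'m \<Rightarrow> real). 0 < \<alpha> \<and> \<alpha> \<le> 1 \<and> holder_on \<alpha> (sphere 0 1) f \<and>
        (\<forall>x \<in> sphere 0 1 - {e, - e}. f x > 0) \<and> \<not> (\<exists>h. Lp_Minkowski_solution TYPE('n) p f h)"
      using holder_on_supercritical[OF e q] q by (intro exI[of _ "min 1 q"] exI[of _ ?f]) auto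
  qed
qed

end
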